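(* Let $l\in\mathbb{N}$, let $(X,\mathcal{T}_1,\ldots,\mathcal{T}_l)$ be a rational dynamical system, let $k\in\mathbb{N}$ and let $k_1<k_2$ be arbitrary real numbers. There exist $x\in X$ and sequences $(\beta_n)_{n\in\mathbb{N}}\subseteq\mathbb{Q}\setminus\mathbb{Z}$, $(\gamma_n)_{n\in\mathbb{N}}\subseteq\mathbb{Z}^\ast$ with $dom^+(\beta_n)=\emptyset=dom^-(\gamma_n)$ and $\beta_n+\gamma_n\prec\beta_{n+1}+\gamma_{n+1}$ for every $n\in\mathbb{N}$, and $\max dom^-(\beta_1)<k_1<k_2<\min dom^+(\gamma_1)$, such that, as $n\to\infty$, $\mathcal{T}_i^{p\beta_n+q\gamma_n}(x)\rightarrow x$ for all integers $0\leq p,q\leq k$, simultaneously for all $1\leq i\leq l$.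
   Context: Notation: $\mathbb{N}=\{1,2,\ldots\}$, $\mathbb{Z}^\ast=\mathbb{Z}\setminus\{0\}$. Expansion of rationals: every rational number $q$ has a unique expression $q=\sum_{s=1}^{\infty}q_{-s}\frac{(-1)^{s}}{(s+1)!}+\sum_{r=1}^{\infty}q_{r}(-1)^{r+1}r!$ with integers $0\leq q_{-s}\leq s$ for $s\geq 1$ and $0\leq q_r\leq r$ for $r\geq 1$, all but finitely many of which are zero. Put $dom(q)=\{t\in\mathbb{Z}^\ast: q_t\neq 0\}$, $dom^-(q)=\{t\in dom(q): t<0\}$, $dom^+(q)=\{t\in dom(q): t>0\}$. For non-zero rationals $q_1,q_2$, write $q_1\prec q_2$ if and only if $\max dom^-(q_2)<\min dom^-(q_1)<\max dom^+(q_1)<\min dom^+(q_2)$. Rational indexed family: given a family $\{T_n\}_{n\in\mathbb{Z}^\ast}$ of pairwise commuting continuous maps $X\to X$, for a non-zero rational $q$ with $dom(q)=\{t_1<\ldots<t_m\}$ put $\mathcal{T}^q(x)=T_{t_1}^{q_{t_1}}\cdots T_{t_m}^{q_{t_m}}(x)$, and put $\mathcal{T}^0(x)=x$. Then $\mathcal{T}=(\mathcal{T}^q)_{q\in\mathbb{Q}}$ is the rational indexed family defined from $\{T_n\}_{n\in\mathbb{Z}^\ast}$. Rational dynamical system: $(X,\mathcal{T}_1,\ldots,\mathcal{T}_l)$ where $X$ is a non-empty compact metric space and, for $1\leq i\leq l$, $\mathcal{T}_i$ is the rational indexed family defined from a family $\{T_{i,n}\}_{n\in\mathbb{Z}^\ast}$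 of homeomorphisms of $X$ onto itself, such that $T_{i,n_1}T_{j,n_2}=T_{j,n_2}T_{i,n_1}$ for all $1\leq i,j\leq l$ and $n_1,n_2\in\mathbb{Z}^\ast$. *)

theory Defs
  imports "HOL-Analysis.Analysis"
begin

text \<open>
  The digits of a rational number \<open>q\<close> are collected in one function on the integers:
  \<open>d (-s)\<close> and \<open>d r\<close> are the coefficients of \<open>(-1)^s / (s+1)!\<close> and \<open>(-1)^(r+1) r!\<close>;
  the unused position 0 carries the digit 0.  Since only finitely many digits are non-zero,
  the two infinite series are sums over the finite sets of positions with non-zero digit.
\<close>

definition is_rat_expansion :: "rat \<Rightarrow> (int \<Rightarrow> nat) \<Rightarrow> bool" where
  "is_rat_expansion q d \<longleftrightarrow>
     d 0 = 0 \<and>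
     (\<forall>s\<ge>1. d (- int s) \<le> s) \<and> (\<forall>r\<ge>1. d (int r) \<le> r) \<and>
     finite {t. d t \<noteq> 0} \<and>
     q = (\<Sum>s | s \<ge> 1 \<and> d (- int s) \<noteq> 0. of_nat (d (- int s)) * ((- 1) ^ s / fact (s + 1)))
       + (\<Sum>r | r \<ge> 1 \<and> d (int r) \<noteq> 0. of_nat (d (int r)) * ((- 1) ^ (r + 1) * fact r))"

definition rat_digit :: "rat \<Rightarrow> int \<Rightarrow> nat" where
  "rat_digit q = (THE d. is_rat_expansion q d)"

lemma rat_expansion_bounded:
  assumes "finite {t::int. d t \<noteq> (0::nat)}"
  shows "\<exists>N. \<forall>n>N. d (int n) = 0 \<and> d (- int n) = 0"
proof -
  have "finite ((\<lambda>t. nat \<bar>t\<bar>) ` {t. d t \<noteq> 0})" using assms by simp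
  then obtain N where N: "\<And>n. n \<in> (\<lambda>t. nat \<bar>t\<bar>) ` {t. d t \<noteq> 0} \<Longrightarrow> n \<le> N"
    by (meson finite_nat_set_iff_bounded_le)
  have "d (int n) = 0 \<and> d (- int n) = 0" if "n > N" for n
  proof (rule ccontr)
    assume "\<not> ?thesis"
    then have "n \<in> (\<lambda>t. nat \<bar>t\<bar>) ` {t. d t \<noteq> 0}"
      by (auto simp: image_iff intro: exI[of _ "int n"] exI[of _ "- int n"])
    then show False using N that by fastforce
  qed
  then show ?thesis by blast
qed

lemma rat_expansion_value:
  fixes d :: "int \<Rightarrow> nat"
  assumes "\<forall>n>N. d (int n) = 0 \<and> d (- int n) = 0"
  shows "(\<Sum>s | s \<ge> 1 \<and> d (- int s) \<noteq> 0. of_nat (d (- int s)) * ((- 1) ^ s / fact (s + 1)))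
       + (\<Sum>r | r \<ge> 1 \<and> d (int r) \<noteq> 0. of_nat (d (int r)) * ((- 1) ^ (r + 1) * fact r))
       = (\<Sum>s=1..N. of_nat (d (- int s)) * ((- 1) ^ s / fact (s + 1)))
       + (\<Sum>r=1..N. of_nat (d (int r)) * ((- 1) ^ (r + 1) * fact r) :: rat)"
proof (intro arg_cong2[where f="(+)"] sum.mono_neutral_left)
  show "{s. 1 \<le> s \<and> d (- int s) \<noteq> 0} \<subseteq> {1..N}" "{s. 1 \<le> s \<and> d (int s) \<noteq> 0} \<subseteq> {1..N}"
    using assms by (auto simp: not_less[symmetric])
qed auto

lemma int_expansion_exists:
  fixes a :: int
  assumes "r \<ge> 1"
  shows "\<exists>d N. (\<forall>j. d j \<le> j) \<and> (\<forall>j<r. d j = 0) \<and> (\<forall>j>N. d j = 0) \<and>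
     a * (- 1) ^ (r + 1) * fact r = (\<Sum>j=1..N. int (d j) * ((- 1) ^ (j + 1) * fact j))"
  using assms
proof (induction "nat (2 * \<bar>a\<bar> + (if a < 0 then 1 else 0))" arbitrary: a r rule: less_induct)
  case less
  show ?case
  proof (cases "a = 0")
    case True
    then show ?thesis by (intro exI[of _ "\<lambda>_. 0"] exI[of _ 0]) auto
  next
    case False
    define b where "b = - (a div (int r + 1))"
    define c where "c = a mod (int r + 1)"
    have c: "0 \<le> c" "c \<le> int r"
      using pos_mod_bound[of "int r + 1" a] by (auto simp: c_def)
    have a: "a = c - (int r + 1) * b"
      by (simp add: b_def c_def)
    have dec: "nat (2 * \<bar>b\<bar> + (if b < 0 then 1 else 0)) < nat (2 * \<bar>a\<bar> + (if a < 0 then 1 else 0))"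
    proof (cases "a < 0")
      case True
      have "b \<ge> 0" using True less.prems by (simp add: b_def div_nonpos_pos_le0)
      moreover have "b \<le> - a"
      proof (rule ccontr)
        assume "\<not> ?thesis"
        then have "b \<ge> 1 - a" by simp
        then have "(int r + 1) * b \<ge> (int r + 1) * (1 - a)" by (intro mult_left_mono) auto
        moreover have "int r * (- a) \<ge> 0" using True by (simp add: mult_nonneg_nonpos)
        ultimately show False using a c by (simp add: algebra_simps)
      qed
      ultimately show ?thesis using True by simp
    next
      case F: False
      then have "b \<le> 0" using less.prems by (simp add: b_def pos_imp_zdiv_nonneg_iff)
      moreover have "2 * (- b) \<le> a"
      proof -
        have "2 * (- b) \<le> (int r + 1) * (- b)"
          using \<open>b \<le> 0\<close> less.prems by (intro mult_right_mono) auto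
        then show ?thesis using a c by simp
      qed
      ultimately show ?thesis using F False by auto
    qed
    obtain d N where d: "\<forall>j. d j \<le> j" "\<forall>j<Suc r. d j = 0" "\<forall>j>N. d j = 0"
      and s: "b * (- 1) ^ (Suc r + 1) * fact (Suc r)
              = (\<Sum>j=1..N. int (d j) * ((- 1) ^ (j + 1) * fact j))"
      using less.hyps[OF dec, of "Suc r"] by auto
    define M where "M = max N r"
    have s': "b * (- 1) ^ (Suc r + 1) * fact (Suc r)
              = (\<Sum>j=1..M. int (d j) * ((- 1) ^ (j + 1) * fact j))"
      unfolding s using d by (intro sum.mono_neutral_left) (auto simp: M_def)
    define e where "e = d(r := nat c)"
    have "(\<Sum>j=1..M. int (e j) * ((- 1) ^ (j + 1) * fact j))
        = int (e r) * ((- 1) ^ (r + 1) * fact r)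
          + (\<Sum>j\<in>{1..M} - {r}. int (e j) * ((- 1) ^ (j + 1) * fact j))"
      using less.prems by (intro sum.remove) (auto simp: M_def)
    also have "(\<Sum>j\<in>{1..M} - {r}. int (e j) * ((- 1) ^ (j + 1) * fact j))
        = (\<Sum>j\<in>{1..M} - {r}. int (d j) * ((- 1) ^ (j + 1) * fact j))"
      by (intro sum.cong) (auto simp: e_def)
    also have "\<dots> = (\<Sum>j=1..M. int (d j) * ((- 1) ^ (j + 1) * fact j))"
      using d by (intro sum.mono_neutral_left) auto
    also have "int (e r) * ((- 1) ^ (r + 1) * fact r) + \<dots> = a * (- 1) ^ (r + 1) * fact r"
      unfolding s'[symmetric] using c by (subst a) (simp add: e_def algebra_simps)
    finally have "a * (- 1) ^ (r + 1) * fact r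
        = (\<Sum>j=1..M. int (e j) * ((- 1) ^ (j + 1) * fact j))" by simp
    then show ?thesis using d c
      by (intro exI[of _ e] exI[of _ M]) (auto simp: e_def M_def)
  qed
qed

lemma frac_expansion_exists:
  fixes z :: int
  shows "\<exists>d m. (\<forall>s. d s \<le> s) \<and> (\<forall>s>N. d s = 0) \<and>
     (of_int z / fact (N + 1) :: rat)
       = (\<Sum>s=1..N. of_nat (d s) * ((- 1) ^ s / fact (s + 1))) + of_int m"
proof (induction N arbitrary: z)
  case 0
  show ?case by (intro exI[of _ "\<lambda>_. 0"] exI[of _ z]) auto
next
  case (Suc N)
  define \<epsilon> :: int where "\<epsilon> = (- 1) ^ Suc N"
  have eps: "\<epsilon> * \<epsilon> = 1" by (simp add: \<epsilon>_def flip: power_add mult_2 power_mult)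
  define c where "c = (\<epsilon> * z) mod (int N + 2)"
  define y where "y = \<epsilon> * ((\<epsilon> * z) div (int N + 2))"
  have c: "0 \<le> c" "c \<le> int (Suc N)"
    using pos_mod_bound[of "int N + 2" "\<epsilon> * z"] by (simp_all add: c_def del: pos_mod_bound)
  have "\<epsilon> * z = (int N + 2) * ((\<epsilon> * z) div (int N + 2)) + c"
    by (simp add: c_def)
  then have "\<epsilon> * (\<epsilon> * z) = \<epsilon> * ((int N + 2) * ((\<epsilon> * z) div (int N + 2)) + c)" by simp
  then have "z = (int N + 2) * y + \<epsilon> * c"
    using eps by (simp add: y_def algebra_simps flip: mult.assoc)
  then have "(of_int z :: rat) = of_int ((int N + 2) * y + \<epsilon> * c)" by simp
  then have "(of_int z :: rat) = (of_nat N + 2) * of_int y + (- 1) ^ Suc N * of_int c"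
    by (simp add: \<epsilon>_def)
  then have z: "(of_int z / fact (Suc N + 1) :: rat)
      = of_int y / fact (N + 1) + of_int c * ((- 1) ^ Suc N / fact (Suc N + 1))"
    by (simp add: divide_simps)
  obtain d m where d: "\<forall>s. d s \<le> s" "\<forall>s>N. d s = 0"
    and s: "(of_int y / fact (N + 1) :: rat)
       = (\<Sum>s=1..N. of_nat (d s) * ((- 1) ^ s / fact (s + 1))) + of_int m"
    using Suc.IH[of y] by auto
  define e where "e = d(Suc N := nat c)"
  have "(\<Sum>s=1..N. of_nat (e s) * ((- 1) ^ s / fact (s + 1)) :: rat)
      = (\<Sum>s=1..N. of_nat (d s) * ((- 1) ^ s / fact (s + 1)))"
    by (intro sum.cong) (auto simp: e_def)
  moreover have "(of_nat (e (Suc N)) :: rat) = of_int c" using c by (simp add: e_def)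
  ultimately have "(of_int z / fact (Suc N + 1) :: rat)
      = (\<Sum>s=1..Suc N. of_nat (e s) * ((- 1) ^ s / fact (s + 1))) + of_int m"
    unfolding z s by simp
  then show ?case using d c
    by (intro exI[of _ e] exI[of _ m]) (auto simp: e_def)
qed

lemma rat_expansion_exists: "\<exists>d. is_rat_expansion q d"
proof -
  obtain a b where q: "q = of_int a / of_int b" "b > 0"
    by (cases q) (auto simp: Fract_of_int_quotient)
  define N where "N = nat b - 1"
  have "nat b dvd fact (nat b)" using q by (intro dvd_fact) auto
  then have "int (nat b) dvd int (fact (nat b))" by (simp only: of_nat_dvd_iff)
  then have "b dvd fact (nat b)" using q by simp
  then obtain c where c: "fact (nat b) = b * c" by blast
  have N: "N + 1 = nat b" using q by (simp add: N_def)
  have "(fact (nat b) :: rat) = of_int (fact (nat b))" by simp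
  then have "(fact (N + 1) :: rat) = of_int b * of_int c" unfolding c N by simp
  moreover have "c \<noteq> 0" using c by auto
  ultimately have q': "q = of_int (a * c) / fact (N + 1)" using q by simp
  obtain d m where d: "\<forall>s. d s \<le> s" "\<forall>s>N. d s = 0"
    and s: "q = (\<Sum>s=1..N. of_nat (d s) * ((- 1) ^ s / fact (s + 1))) + of_int m"
    using frac_expansion_exists[of N "a * c"] unfolding q' by blast
  obtain e M where e: "\<forall>j. e j \<le> j" "\<forall>j>M. e j = 0"
    and m: "m = (\<Sum>j=1..M. int (e j) * ((- 1) ^ (j + 1) * fact j))"
    using int_expansion_exists[of 1 m] by auto
  have m': "(of_int m :: rat) = (\<Sum>j=1..M. of_nat (e j) * ((- 1) ^ (j + 1) * fact j))"
    unfolding m by simp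
  define f where "f t = (if t < 0 then d (nat (- t)) else e (nat t))" for t :: int
  have f: "f (- int s) = d s" "f (int s) = e s" for s
    using d(1)[rule_format, of 0] e(1)[rule_format, of 0] by (auto simp: f_def)
  define K where "K = max N M"
  have K: "\<forall>n>K. f (int n) = 0 \<and> f (- int n) = 0"
    using d e by (simp add: f K_def)
  have "{t. f t \<noteq> 0} \<subseteq> {- int K..int K}"
  proof
    fix t assume "t \<in> {t. f t \<noteq> 0}"
    then have "\<not> nat \<bar>t\<bar> > K" using K[rule_format, of "nat \<bar>t\<bar>"] by (cases "t < 0") auto
    then show "t \<in> {- int K..int K}" by auto
  qed
  then have fin: "finite {t. f t \<noteq> 0}" by (rule finite_subset) simp
  have "(\<Sum>s=1..N. of_nat (d s) * ((- 1) ^ s / fact (s + 1)) :: rat)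
      = (\<Sum>s=1..K. of_nat (d s) * ((- 1) ^ s / fact (s + 1)))"
    using d by (intro sum.mono_neutral_left) (auto simp: K_def)
  moreover have "(\<Sum>j=1..M. of_nat (e j) * ((- 1) ^ (j + 1) * fact j) :: rat)
      = (\<Sum>j=1..K. of_nat (e j) * ((- 1) ^ (j + 1) * fact j))"
    using e by (intro sum.mono_neutral_left) (auto simp: K_def)
  ultimately have "q = (\<Sum>s=1..K. of_nat (f (- int s)) * ((- 1) ^ s / fact (s + 1)))
       + (\<Sum>r=1..K. of_nat (f (int r)) * ((- 1) ^ (r + 1) * fact r))"
    unfolding s m' f by simp
  moreover have "f 0 = 0" using e(1)[rule_format, of 0] by (simp add: f_def)
  ultimately have "is_rat_expansion q f"
    unfolding is_rat_expansion_def using rat_expansion_value[of K f, OF K] fin d e by (simp add: f)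
  then show ?thesis by blast
qed

lemma dvd_small_imp_zero:
  fixes c :: int
  assumes "(int n + 1) dvd c" "\<bar>c\<bar> \<le> int n"
  shows "c = 0"
  using assms zdvd_imp_le[of "int n + 1" "\<bar>c\<bar>"] by fastforce

lemma frac_expansion_unique:
  fixes c :: "nat \<Rightarrow> int"
  assumes "\<And>s. \<bar>c s\<bar> \<le> int s"
    and "(\<Sum>s=1..N. of_int (c s) * ((- 1) ^ s / fact (s + 1))) = (of_int m :: rat)"
  shows "\<forall>s\<in>{1..N}. c s = 0"
  using assms(2)
proof (induction N)
  case (Suc N)
  define A where "A = (\<Sum>s=1..N. c s * ((- 1) ^ s * (fact (N + 1) div fact (s + 1))))"
  have "(fact (N + 1) :: rat) / fact (s + 1) = of_int (fact (N + 1) div fact (s + 1))"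
    if "s \<le> N" for s
  proof -
    have "(fact (s + 1) :: int) dvd fact (N + 1)" using that by (intro fact_dvd) simp
    then have "(of_int (fact (N + 1) div fact (s + 1)) :: rat)
        = of_int (fact (N + 1)) / of_int (fact (s + 1))"
      by (rule of_int_div)
    then show ?thesis by simp
  qed
  then have A: "(of_int A :: rat)
      = fact (N + 1) * (\<Sum>s=1..N. of_int (c s) * ((- 1) ^ s / fact (s + 1)))"
    unfolding A_def sum_distrib_left of_int_sum
    by (intro sum.cong) (auto simp: field_simps simp del: fact_Suc)
  have "(fact (Suc N + 1) :: rat) = (of_nat N + 2) * fact (N + 1)" by simp
  then have "fact (Suc N + 1) * (\<Sum>s=1..N. of_int (c s) * ((- 1) ^ s / fact (s + 1)))
      = (of_nat N + 2) * (of_int A :: rat)"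
    unfolding A by (simp only: mult.assoc)
  then have "fact (Suc N + 1) * (\<Sum>s=1..Suc N. of_int (c s) * ((- 1) ^ s / fact (s + 1)))
      = (of_nat N + 2) * of_int A + (of_int (c (Suc N)) * (- 1) ^ Suc N :: rat)"
    by (simp add: distrib_left right_diff_distrib del: fact_Suc)
  then have "of_int ((int N + 2) * A + c (Suc N) * (- 1) ^ Suc N)
      = (of_int (fact (Suc N + 1) * m) :: rat)"
    unfolding Suc.prems by simp
  then have "(int N + 2) * A + c (Suc N) * (- 1) ^ Suc N = fact (Suc N + 1) * m"
    by (simp only: of_int_eq_iff)
  moreover have "(fact (Suc N + 1) :: int) = (int N + 2) * fact (N + 1)" by simp
  ultimately have "c (Suc N) * (- 1) ^ Suc N = (int N + 2) * (fact (N + 1) * m - A)"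
    by (simp add: algebra_simps)
  then have "(int N + 2) dvd c (Suc N) * (- 1) ^ Suc N" by (rule dvdI)
  then have "(int (Suc N) + 1) dvd c (Suc N) * (- 1) ^ Suc N"
    by (simp only: of_nat_Suc) (simp add: add.commute)
  then have "(int (Suc N) + 1) dvd c (Suc N)"
    by (cases "even N") (auto simp: algebra_simps)
  then have "c (Suc N) = 0" using assms(1) dvd_small_imp_zero by blast
  moreover from this have "\<forall>s\<in>{1..N}. c s = 0" using Suc by simp
  ultimately show ?case by (simp add: atLeastAtMostSuc_conv)
qed simp

lemma int_expansion_unique:
  fixes c :: "nat \<Rightarrow> int"
  assumes "\<And>j. \<bar>c j\<bar> \<le> int j"
    and "(\<Sum>j=1..N. c j * ((- 1) ^ (j + 1) * fact j)) = 0"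
  shows "r \<in> {1..N} \<Longrightarrow> c r = 0"
proof (induction r rule: less_induct)
  case (less r)
  have "(\<Sum>j=1..N. c j * ((- 1) ^ (j + 1) * fact j))
      = c r * ((- 1) ^ (r + 1) * fact r)
        + (\<Sum>j\<in>{1..N} - {r}. c j * ((- 1) ^ (j + 1) * fact j))"
    using less.prems by (intro sum.remove) auto
  moreover have "fact (r + 1) dvd (\<Sum>j\<in>{1..N} - {r}. c j * ((- 1) ^ (j + 1) * fact j))"
  proof (rule dvd_sum)
    fix j assume j: "j \<in> {1..N} - {r}"
    show "fact (r + 1) dvd c j * ((- 1) ^ (j + 1) * fact j)"
    proof (cases "j < r")
      case True then show ?thesis using less.IH j by simp
    next
      case False
      then have "(fact (r + 1) :: int) dvd fact j" using j by (intro fact_dvd) auto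
      then show ?thesis by (intro dvd_mult)
    qed
  qed
  ultimately have "(fact (r + 1) :: int) dvd c r * ((- 1) ^ (r + 1) * fact r)"
    using assms(2) dvd_add_left_iff[of "fact (r + 1)"
        "\<Sum>j\<in>{1..N} - {r}. c j * ((- 1) ^ (j + 1) * fact j)"
        "c r * ((- 1) ^ (r + 1) * fact r)"] by (simp del: fact_Suc)
  then have "(int r + 1) * fact r dvd (c r * (- 1) ^ (r + 1)) * fact r"
    by (simp add: algebra_simps)
  then have "(int r + 1) dvd c r * (- 1) ^ (r + 1)"
    by (subst (asm) dvd_mult_cancel_right) simp
  then have "(int r + 1) dvd c r" by (cases "even r") auto
  then show ?case using assms(1) dvd_small_imp_zero by blast
qed

lemma rat_expansion_unique:
  assumes "is_rat_expansion q d" "is_rat_expansion q e"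
  shows "d = e"
proof -
  obtain N1 where N1: "\<forall>n>N1. d (int n) = 0 \<and> d (- int n) = 0"
    using rat_expansion_bounded assms(1) unfolding is_rat_expansion_def by blast
  obtain N2 where N2: "\<forall>n>N2. e (int n) = 0 \<and> e (- int n) = 0"
    using rat_expansion_bounded assms(2) unfolding is_rat_expansion_def by blast
  define N where "N = max N1 N2"
  have N: "\<forall>n>N. d (int n) = 0 \<and> d (- int n) = 0" "\<forall>n>N. e (int n) = 0 \<and> e (- int n) = 0"
    using N1 N2 by (auto simp: N_def)
  define c where "c t = int (d t) - int (e t)" for t
  have cb: "\<bar>c (int s)\<bar> \<le> int s" "\<bar>c (- int s)\<bar> \<le> int s" for s
  proof -
    have "d (int s) \<le> s \<and> d (- int s) \<le> s \<and> e (int s) \<le> s \<and> e (- int s) \<le> s"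
      using assms unfolding is_rat_expansion_def by (cases "s = 0") auto
    then show "\<bar>c (int s)\<bar> \<le> int s" "\<bar>c (- int s)\<bar> \<le> int s" by (auto simp: c_def)
  qed
  have qd: "q = (\<Sum>s=1..N. of_nat (d (- int s)) * ((- 1) ^ s / fact (s + 1)))
       + (\<Sum>r=1..N. of_nat (d (int r)) * ((- 1) ^ (r + 1) * fact r))"
    using assms(1) rat_expansion_value[of N d, OF N(1)] unfolding is_rat_expansion_def by argo
  have qe: "q = (\<Sum>s=1..N. of_nat (e (- int s)) * ((- 1) ^ s / fact (s + 1)))
       + (\<Sum>r=1..N. of_nat (e (int r)) * ((- 1) ^ (r + 1) * fact r))"
    using assms(2) rat_expansion_value[of N e, OF N(2)] unfolding is_rat_expansion_def by argo
  define P where "P = (\<Sum>r=1..N. c (int r) * ((- 1) ^ (r + 1) * fact r))"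
  have F: "(\<Sum>s=1..N. of_int (c (- int s)) * ((- 1) ^ s / fact (s + 1)))
      = (\<Sum>s=1..N. of_nat (d (- int s)) * ((- 1) ^ s / fact (s + 1)))
       - (\<Sum>s=1..N. of_nat (e (- int s)) * ((- 1) ^ s / fact (s + 1)) :: rat)"
    unfolding sum_subtractf[symmetric] by (intro sum.cong) (auto simp: c_def left_diff_distrib diff_divide_distrib)
  have P: "(of_int P :: rat) = (\<Sum>r=1..N. of_nat (d (int r)) * ((- 1) ^ (r + 1) * fact r))
       - (\<Sum>r=1..N. of_nat (e (int r)) * ((- 1) ^ (r + 1) * fact r))"
    unfolding sum_subtractf[symmetric] P_def of_int_sum
    by (intro sum.cong) (auto simp: c_def left_diff_distrib diff_divide_distrib)
  have 1: "(\<Sum>s=1..N. of_int (c (- int s)) * ((- 1) ^ s / fact (s + 1))) = (of_int (- P) :: rat)"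
    using F P qd qe by simp
  have neg: "\<forall>s\<in>{1..N}. c (- int s) = 0"
    by (rule frac_expansion_unique[OF cb(2) 1])
  then have "P = 0" using 1 by simp
  then have pos: "c (int r) = 0" if "r \<in> {1..N}" for r
    using int_expansion_unique[of "\<lambda>r. c (int r)" N, OF cb(1)] that unfolding P_def by blast
  have z: "d 0 = 0" "e 0 = 0" using assms by (auto simp: is_rat_expansion_def)
  show ?thesis
  proof
    fix t
    define n where "n = nat \<bar>t\<bar>"
    have t: "t = int n \<or> t = - int n" by (auto simp: n_def)
    consider "n = 0" | "n \<in> {1..N}" | "n > N" by fastforce
    then show "d t = e t"
    proof cases
      case 1 then show ?thesis using t z by auto
    next
      case 2 then show ?thesis using t pos neg by (auto simp: c_def)
    next
      case 3 then show ?thesis using t N by auto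
    qed
  qed
qed

lemma rat_expansion_ex1: "\<exists>!d. is_rat_expansion q d"
  using rat_expansion_exists rat_expansion_unique by blast

definition rdom :: "rat \<Rightarrow> int set" where
  "rdom q = {t. t \<noteq> 0 \<and> rat_digit q t \<noteq> 0}"

definition rdom_neg :: "rat \<Rightarrow> int set" where
  "rdom_neg q = {t \<in> rdom q. t < 0}"

definition rdom_pos :: "rat \<Rightarrow> int set" where
  "rdom_pos q = {t \<in> rdom q. t > 0}"

text \<open>
  The maxima and minima below only make sense for non-empty sets, so the order is taken to hold
  only between rationals having digits on both sides.
\<close>

definition rat_prec :: "rat \<Rightarrow> rat \<Rightarrow> bool" (infix \<open>\<prec>\<close> 50) where
  "q1 \<prec> q2 \<longleftrightarrow>
     rdom_neg q1 \<noteq> {} \<and> rdom_pos q1 \<noteq> {} \<and> rdom_neg q2 \<noteq> {} \<and> rdom_pos q2 \<noteq> {} \<and>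
     Max (rdom_neg q2) < Min (rdom_neg q1) \<and>
     Min (rdom_neg q1) < Max (rdom_pos q1) \<and>
     Max (rdom_pos q1) < Min (rdom_pos q2)"

text \<open>
  The composition over the positions of \<open>q\<close> in increasing order; the value \<open>T 0\<close> is never used,
  and for \<open>q = 0\<close> the list is empty and the result is the identity.
\<close>

definition rational_family :: "(int \<Rightarrow> 'a \<Rightarrow> 'a) \<Rightarrow> rat \<Rightarrow> 'a \<Rightarrow> 'a" where
  "rational_family T q =
     foldr (\<lambda>t f. (T t ^^ rat_digit q t) \<circ> f) (sorted_list_of_set (rdom q)) id"

text \<open>
  The space is the carrier set \<open>X\<close>; maps are only constrained on \<open>X\<close>.  The families are indexed by
  \<open>1, \<dots>, l\<close>.
\<close>

definition rational_dynamical_system ::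
  "'a::metric_space set \<Rightarrow> nat \<Rightarrow> (nat \<Rightarrow> rat \<Rightarrow> 'a \<Rightarrow> 'a) \<Rightarrow> bool" where
  "rational_dynamical_system X l \<T> \<longleftrightarrow>
     X \<noteq> {} \<and> compact X \<and>
     (\<exists>T :: nat \<Rightarrow> int \<Rightarrow> 'a \<Rightarrow> 'a.
        (\<forall>i\<in>{1..l}. \<forall>n. n \<noteq> 0 \<longrightarrow> (\<exists>S. homeomorphism X X (T i n) S)) \<and>
        (\<forall>i\<in>{1..l}. \<forall>j\<in>{1..l}. \<forall>m n. m \<noteq> 0 \<longrightarrow> n \<noteq> 0 \<longrightarrow>
           (\<forall>x\<in>X. T i m (T j n x) = T j n (T i m x))) \<and>
        (\<forall>i\<in>{1..l}. \<forall>q. \<forall>x\<in>X. \<T> i q x = rational_family (T i) q x))"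

lemma is_rat_expansion_rat_digit: "is_rat_expansion q (rat_digit q)"
  unfolding rat_digit_def by (rule theI'[OF rat_expansion_ex1])

lemma finite_rdom: "finite (rdom q)"
  using is_rat_expansion_rat_digit[of q]
  by (auto simp: rdom_def is_rat_expansion_def elim: rev_finite_subset)

lemma rdom_zero: "rdom 0 = {}"
proof -
  have "is_rat_expansion 0 (\<lambda>_. 0)" by (simp add: is_rat_expansion_def)
  then have "rat_digit 0 = (\<lambda>_. 0)"
    using is_rat_expansion_rat_digit rat_expansion_unique by blast
  then show ?thesis by (simp add: rdom_def)
qed

lemma rational_family_zero: "rational_family T 0 x = x"
  by (simp add: rational_family_def rdom_zero)

end

theory Submission
  imports Defs
begin

text \<open>
  Let \<open>A\<close> be a finite set of positive integers with all elements at least \<open>k\<close>, and let \<open>b\<close>, \<open>c\<close> be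
  the rationals with digit 1 exactly at the positions in \<open>-A\<close>, respectively \<open>A\<close>.  For \<open>p, q \<le> k\<close> no
  carries occur in \<open>p b + q c\<close>, so it acts by the product over \<open>m \<in> A\<close> of the commuting
  homeomorphisms \<open>T_{-m}^p T_m^q\<close>.  The claim thus reduces to the IP multiple recurrence theorem of
  Furstenberg and Weiss for the finitely many families indexed by \<open>(i, p, q)\<close>.

  That theorem is proved on a minimal subset by induction on the number of families.  Applying the
  hypothesis to the quotients \<open>w_a^{-1} w_j\<close> again and again gives non-empty open sets \<open>U_0, U_1, \<dots>\<close>
  and successive blocks \<open>\<alpha>_n\<close> such that every family maps \<open>U_{n+1}\<close> into \<open>U_n\<close> along \<open>\<alpha>_{n+1}\<close>,
  where by minimality each \<open>U_n\<close> is moved into the target set \<open>V\<close> by one of finitely many group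
  elements.  Two of the \<open>U_n\<close> share the same element, and the blocks between them yield a return
  to \<open>V\<close>.  Nested balls then turn returns to arbitrary open sets into one recurrent point.
\<close>

section \<open>Products of maps along lists of indices\<close>

text \<open>The same right fold as in \<open>rational_family\<close>, with an arbitrary factor
  \<open>w t\<close> in place of a power. Over an increasing list it is the IP product along a
  finite set of indices.\<close>

definition comp_list :: "('i \<Rightarrow> 'a \<Rightarrow> 'a) \<Rightarrow> 'i list \<Rightarrow> 'a \<Rightarrow> 'a" where
  "comp_list w xs = foldr (\<lambda>t f. w t \<circ> f) xs id"

lemma comp_list_Nil [simp]: "comp_list w [] = id"
  and comp_list_Cons [simp]: "comp_list w (t # xs) = w t \<circ> comp_list w xs"
  by (simp_all add: comp_list_def)

lemma comp_list_append: "comp_list w (xs @ ys) = comp_list w xs \<circ> comp_list w ys"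
  by (induction xs) (auto simp: comp_assoc)

section \<open>Commuting groups of homeomorphisms\<close>

text \<open>Bijectivity and commutation are demanded on the whole type, compactness and continuity
  only on \<open>Y\<close>. Thus \<open>inv\<close> is a true group inverse, and the same
  \<open>G\<close> still serves when \<open>Y\<close> shrinks to an invariant subset.\<close>

locale commuting_homeos =
  fixes Y :: "'a::metric_space set" and G :: "('a \<Rightarrow> 'a) set"
  assumes compact: "compact Y" and nonempty: "Y \<noteq> {}"
    and id_mem: "id \<in> G"
    and comp_mem: "f \<in> G \<Longrightarrow> g \<in> G \<Longrightarrow> f \<circ> g \<in> G"
    and inv_mem: "f \<in> G \<Longrightarrow> inv f \<in> G"
    and commute: "f \<in> G \<Longrightarrow> g \<in> G \<Longrightarrow> f \<circ> g = g \<circ> f"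
    and bij: "f \<in> G \<Longrightarrow> bij f"
    and image_eq: "f \<in> G \<Longrightarrow> f ` Y = Y"
    and continuous: "f \<in> G \<Longrightarrow> continuous_on Y f"
begin

lemma app_mem: "f \<in> G \<Longrightarrow> y \<in> Y \<Longrightarrow> f y \<in> Y"
  using image_eq by blast

lemma comp_list_mem: "(\<And>t. t \<in> set xs \<Longrightarrow> w t \<in> G) \<Longrightarrow> comp_list w xs \<in> G"
  by (induction xs) (auto simp del: o_apply intro: id_mem comp_mem)

lemma funpow_mem: "f \<in> G \<Longrightarrow> f ^^ n \<in> G"
  by (induction n) (auto simp del: o_apply intro: id_mem comp_mem)

lemma commute_app: "f \<in> G \<Longrightarrow> g \<in> G \<Longrightarrow> f (g x) = g (f x)"
  using commute by (metis o_apply)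

lemma inv_app: "f \<in> G \<Longrightarrow> inv f (f x) = x" "f \<in> G \<Longrightarrow> f (inv f x) = x"
  using bij by (simp_all add: bij_is_inj bij_is_surj surj_f_inv_f)

text \<open>In an abelian group the denominators cancel factor by factor. This translates a return
  of the quotients into a statement about the families \<open>v\<close> and \<open>w\<close>
  themselves.\<close>

lemma comp_list_quotient:
  assumes "\<And>t. t \<in> set xs \<Longrightarrow> v t \<in> G" "\<And>t. t \<in> set xs \<Longrightarrow> w t \<in> G"
  shows "comp_list v xs (comp_list (\<lambda>t. inv (v t) \<circ> w t) xs x) = comp_list w xs x"
  using assms
proof (induction xs)
  case (Cons t xs)
  let ?v = "comp_list v xs" and ?r = "comp_list (\<lambda>t. inv (v t) \<circ> w t) xs"
  have G: "?v \<in> G" "v t \<in> G" "inv (v t) \<circ> w t \<in> G"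
    using Cons.prems by (auto simp del: o_apply intro!: comp_list_mem comp_mem inv_mem)
  have "v t (?v ((inv (v t) \<circ> w t) (?r x))) = v t ((inv (v t) \<circ> w t) (?v (?r x)))"
    using commute_app[OF G(1) G(3)] by (rule arg_cong)
  also have "\<dots> = w t (?v (?r x))"
    using G by (simp only: o_apply inv_app)
  also have "?v (?r x) = comp_list w xs x"
    using Cons.prems by (intro Cons.IH) auto
  finally show ?case by (simp only: comp_list_Cons o_apply)
qed simp

lemma openin_preimage:
  "f \<in> G \<Longrightarrow> openin (top_of_set Y) U \<Longrightarrow> openin (top_of_set Y) {y \<in> Y. f y \<in> U}"
  using continuous_openin_preimage[OF continuous, of f Y U] app_mem
  by (auto simp: vimage_def Int_def Pi_def)

lemma openin_preimages:
  assumes "finite J" "\<And>j. j \<in> J \<Longrightarrow> f j \<in> G" "openin (top_of_set Y) U"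
  shows "openin (top_of_set Y) {y \<in> Y. \<forall>j\<in>J. f j y \<in> U}"
  using assms
proof (induction J rule: finite_induct)
  case (insert a J)
  have "openin (top_of_set Y) ({y \<in> Y. f a y \<in> U} \<inter> {y \<in> Y. \<forall>j\<in>J. f j y \<in> U})"
    using insert by (intro openin_Int openin_preimage) auto
  then show ?case by (rule back_subst) auto
qed simp

end

section \<open>Minimal subsystems\<close>

locale minimal_commuting_homeos = commuting_homeos +
  assumes minimal: "closed A \<Longrightarrow> A \<subseteq> Y \<Longrightarrow> A \<noteq> {} \<Longrightarrow> (\<And>g. g \<in> G \<Longrightarrow> g ` A \<subseteq> A) \<Longrightarrow> A = Y"

text \<open>Zorn's lemma for the non-empty closed invariant sets under reverse inclusion; a chain is
  bounded by its intersection, which is non-empty by compactness.\<close>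

lemma (in commuting_homeos) minimal_subset_exists:
  "\<exists>Z\<subseteq>Y. minimal_commuting_homeos Z G"
proof -
  define \<A> where "\<A> = {A. closed A \<and> A \<subseteq> Y \<and> A \<noteq> {} \<and> (\<forall>g\<in>G. g ` A \<subseteq> A)}"
  have "\<exists>Z\<in>\<A>. \<forall>A\<in>\<A>. A \<subseteq> Z \<longrightarrow> A = Z"
  proof (rule predicate_Zorn)
    show "partial_order_on \<A> (relation_of (\<lambda>A B. B \<subseteq> A) \<A>)"
      by (rule partial_order_on_relation_ofI) auto
    fix C assume C: "C \<in> Chains (relation_of (\<lambda>A B. B \<subseteq> A) \<A>)"
    then have CA: "C \<subseteq> \<A>" by (rule Chains_relation_of)
    have chain: "A \<subseteq> B \<or> B \<subseteq> A" if "A \<in> C" "B \<in> C" for A B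
      using C that by (auto simp: Chains_def relation_of_def)
    have fin: "Y \<inter> \<Inter>F \<noteq> {}" if "finite F" "F \<subseteq> C" for F
    proof (cases "F = {}")
      case False
      \<comment> \<open>A finite non-empty subfamily of a chain contains its own intersection, which
        is therefore a member of \<open>\<A>\<close> and non-empty.\<close>
      have "A \<inter> B \<in> F" if "A \<in> F" "B \<in> F" for A B
      proof -
        have "A \<subseteq> B \<or> B \<subseteq> A" using that \<open>F \<subseteq> C\<close> by (intro chain) auto
        then show ?thesis using that by (metis Int_absorb1 Int_absorb2)
      qed
      then have "\<Inter>F \<in> F"
        using that(1) False by (intro finite_Inf_in) auto
      then have "\<Inter>F \<in> \<A>" using that(2) CA by (meson subsetD)
      then have "\<Inter>F \<subseteq> Y" "\<Inter>F \<noteq> {}" by (simp_all add: \<A>_def)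
      then show ?thesis by (metis Int_absorb1)
    qed (use nonempty in auto)
    \<comment> \<open>Intersecting with \<open>Y\<close> also covers the empty chain, whose bound is
      then \<open>Y\<close> itself.\<close>
    have "Y \<inter> \<Inter>C \<noteq> {}"
    proof (rule compact_imp_fip[OF compact])
      show "closed A" if "A \<in> C" for A using that CA by (auto simp: \<A>_def)
    qed (rule fin)
    moreover have "closed (Y \<inter> \<Inter>C)"
      using CA compact by (intro closed_Int closed_Inter) (auto simp: \<A>_def compact_imp_closed)
    moreover have "g ` (Y \<inter> \<Inter>C) \<subseteq> Y \<inter> \<Inter>C" if "g \<in> G" for g
      using CA that app_mem by (fastforce simp: \<A>_def)
    ultimately have "Y \<inter> \<Inter>C \<in> \<A>" by (auto simp: \<A>_def)
    then show "\<exists>u\<in>\<A>. \<forall>a\<in>C. u \<subseteq> a"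
      by (rule rev_bexI) (simp add: Inter_lower le_infI2)
  qed
  then obtain Z where Z: "Z \<in> \<A>" and min: "\<And>A. A \<in> \<A> \<Longrightarrow> A \<subseteq> Z \<Longrightarrow> A = Z" by blast
  have "minimal_commuting_homeos Z G"
  proof
    show "compact Z"
      using Z compact_Int_closed[OF compact, of Z] by (auto simp: \<A>_def Int_absorb1)
    show "f ` Z = Z" if f: "f \<in> G" for f
    proof
      \<comment> \<open>The inverse of \<open>f\<close> is in \<open>G\<close> too and maps
        \<open>Z\<close> into itself, which turns the inclusion into an equality.\<close>
      show "Z \<subseteq> f ` Z"
      proof
        fix z assume "z \<in> Z"
        then have "inv f z \<in> Z" using Z inv_mem[OF f] by (auto simp: \<A>_def)
        then show "z \<in> f ` Z" using inv_app(2)[OF f] by (metis image_eqI)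
      qed
    qed (use Z f in \<open>auto simp: \<A>_def\<close>)
    show "continuous_on Z f" if "f \<in> G" for f
      using continuous[OF that] Z continuous_on_subset by (auto simp: \<A>_def)
    show "A = Z" if "closed A" "A \<subseteq> Z" "A \<noteq> {}" "\<And>g. g \<in> G \<Longrightarrow> g ` A \<subseteq> A" for A
    proof (rule min)
      show "A \<in> \<A>" using that Z by (simp add: \<A>_def) blast
    qed fact
  qed (use Z id_mem comp_mem inv_mem commute bij in \<open>auto simp: \<A>_def\<close>)
  then show ?thesis using Z by (auto simp: \<A>_def)
qed

context minimal_commuting_homeos
begin

text \<open>The points whose whole orbit misses \<open>V\<close> form a closed invariant set. Were
  it non-empty, minimality would make it all of \<open>Y\<close>, although points of
  \<open>V\<close> are outside it. So the preimages of \<open>V\<close> cover \<open>Y\<close>, and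
  compactness leaves finitely many.\<close>

lemma finite_translates_cover:
  assumes V: "openin (top_of_set Y) V" "V \<noteq> {}"
  obtains F where "finite F" "F \<subseteq> G" "\<forall>y\<in>Y. \<exists>g\<in>F. g y \<in> V"
proof -
  define A where "A = Y - (\<Union>g\<in>G. {y \<in> Y. g y \<in> V})"
  have op: "openin (top_of_set Y) (\<Union>g\<in>G. {y \<in> Y. g y \<in> V})"
    using V by (intro openin_clauses(3)) (auto intro: openin_preimage)
  have cov: "Y \<subseteq> (\<Union>g\<in>G. {y \<in> Y. g y \<in> V})"
  proof (rule ccontr)
    assume "\<not> ?thesis"
    then have "A \<noteq> {}" by (auto simp: A_def)
    moreover have "closed A"
    proof (rule closedin_closed_trans)
      show "closedin (top_of_set Y) A"
        using op by (auto simp: A_def intro: closedin_diff)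
    qed (simp add: compact compact_imp_closed)
    moreover have "g ` A \<subseteq> A" if "g \<in> G" for g
    proof clarify
      fix y assume y: "y \<in> A"
      have "h (g y) \<notin> V" if "h \<in> G" for h
        using y comp_mem[OF that \<open>g \<in> G\<close>] by (force simp: A_def)
      then show "g y \<in> A" using y app_mem[OF that] by (auto simp: A_def)
    qed
    moreover have "A \<subseteq> Y" unfolding A_def by (rule Diff_subset)
    ultimately have "A = Y" by (intro minimal)
    obtain v where v: "v \<in> V" using V by blast
    then have "v \<in> Y" using openin_imp_subset[OF V(1)] by blast
    then have "v \<in> (\<Union>g\<in>G. {y \<in> Y. g y \<in> V})" using v by (intro UN_I[OF id_mem]) simp
    then have "v \<notin> A" unfolding A_def by (simp only: Diff_iff not_True_eq_False simp_thms)
    then show False using \<open>v \<in> Y\<close> \<open>A = Y\<close> by simp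
  qed
  have "\<forall>T\<in>((\<lambda>g. {y \<in> Y. g y \<in> V}) ` G). openin (top_of_set Y) T"
    using V by (auto intro: openin_preimage)
  then obtain D where D: "D \<subseteq> (\<lambda>g. {y \<in> Y. g y \<in> V}) ` G" "finite D" "Y \<subseteq> \<Union>D"
    using compact_eq_openin_cover[THEN iffD1, OF compact, rule_format,
        of "(\<lambda>g. {y \<in> Y. g y \<in> V}) ` G"] cov by blast
  then obtain F where "F \<subseteq> G" "finite F" "D = (\<lambda>g. {y \<in> Y. g y \<in> V}) ` F"
    using finite_subset_image[OF D(2,1)] by blast
  then show ?thesis using D(3) by (intro that[of F]) auto
qed

section \<open>Returns of finitely many IP families to an open set\<close>

text \<open>IP multiple recurrence for families indexed by \<open>J\<close>: the strictly increasing
  list \<alpha> stands for a finite set of indices. The families are quantified inside, so that an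
  induction hypothesis applies to quotients, and the bound \<open>N\<close> allows each new block to
  start after all earlier ones.\<close>

definition jointly_recurrent :: "'j set \<Rightarrow> bool" where
  "jointly_recurrent J \<longleftrightarrow>
     (\<forall>w V N. (\<forall>j\<in>J. \<forall>m::nat. w j m \<in> G) \<and> openin (top_of_set Y) V \<and> V \<noteq> {} \<longrightarrow>
        (\<exists>\<alpha>. \<alpha> \<noteq> [] \<and> sorted_wrt (<) \<alpha> \<and> (\<forall>m\<in>set \<alpha>. N < m) \<and>
           (\<exists>x\<in>V. \<forall>j\<in>J. comp_list (w j) \<alpha> x \<in> V)))"

lemma jointly_recurrentE:
  assumes "jointly_recurrent J" "\<forall>j\<in>J. \<forall>m::nat. w j m \<in> G"
    and "openin (top_of_set Y) V" "V \<noteq> {}"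
  obtains \<alpha> x where "\<alpha> \<noteq> []" "sorted_wrt (<) \<alpha>" "\<forall>m\<in>set \<alpha>. N < m"
    "x \<in> V" "\<forall>j\<in>J. comp_list (w j) \<alpha> x \<in> V"
proof -
  have "(\<forall>j\<in>J. \<forall>m. w j m \<in> G) \<and> openin (top_of_set Y) V \<and> V \<noteq> {}"
    using assms(2-) by simp
  from assms(1)[unfolded jointly_recurrent_def, rule_format, OF this, of N]
  show ?thesis using that by blast
qed

lemma jointly_recurrent_empty: "jointly_recurrent {}"
  unfolding jointly_recurrent_def
proof (intro allI impI)
  fix w :: "'b \<Rightarrow> nat \<Rightarrow> 'a \<Rightarrow> 'a" and V and N :: nat
  assume "(\<forall>j\<in>{}. \<forall>m::nat. w j m \<in> G) \<and> openin (top_of_set Y) V \<and> V \<noteq> {}"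
  then show "\<exists>\<alpha>. \<alpha> \<noteq> [] \<and> sorted_wrt (<) \<alpha> \<and> (\<forall>m\<in>set \<alpha>. N < m) \<and>
      (\<exists>x\<in>V. \<forall>j\<in>{}. comp_list (w j) \<alpha> x \<in> V)"
    by (intro exI[of _ "[Suc N]"]) auto
qed

text \<open>Let \<open>f\<close> be the product of \<open>w a\<close> along the block by which the
  quotients return \<open>x\<close> to \<open>V\<close>. For \<open>y = inv f x\<close>, the family
  \<open>a\<close> sends \<open>y\<close> to \<open>x\<close>, and every other family sends it to
  the image of \<open>x\<close> under its quotient. Thus one more family is handled, at the price
  that \<open>y\<close> need only lie in \<open>Y\<close>.\<close>

lemma common_return:
  assumes "jointly_recurrent J" "\<forall>j\<in>insert a J. \<forall>m::nat. w j m \<in> G"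
    and V: "openin (top_of_set Y) V" "V \<noteq> {}"
  obtains \<alpha> y where "\<alpha> \<noteq> []" "sorted_wrt (<) \<alpha>" "\<forall>m\<in>set \<alpha>. N < m" "y \<in> Y"
    "\<forall>j\<in>insert a J. comp_list (w j) \<alpha> y \<in> V"
proof -
  define r where "r j m = inv (w a m) \<circ> w j m" for j and m :: nat
  have r: "\<forall>j\<in>J. \<forall>m. r j m \<in> G"
    using assms(2) by (auto simp: r_def simp del: o_apply intro!: comp_mem inv_mem)
  obtain \<alpha> x where \<alpha>: "\<alpha> \<noteq> []" "sorted_wrt (<) \<alpha>" "\<forall>m\<in>set \<alpha>. N < m"
    and x: "x \<in> V" "\<forall>j\<in>J. comp_list (r j) \<alpha> x \<in> V"
    using jointly_recurrentE[where N = N, OF assms(1) r V] .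
  let ?f = "comp_list (w a) \<alpha>"
  have f: "?f \<in> G" using assms(2) by (intro comp_list_mem) auto
  have "comp_list (w j) \<alpha> (inv ?f x) \<in> V" if "j \<in> J" for j
  proof -
    have r': "comp_list (r j) \<alpha> \<in> G"
      using that r by (intro comp_list_mem) auto
    have "comp_list (w j) \<alpha> (inv ?f x) = ?f (comp_list (r j) \<alpha> (inv ?f x))"
      unfolding r_def using assms(2) that by (intro comp_list_quotient[symmetric]) auto
    also have "\<dots> = comp_list (r j) \<alpha> (?f (inv ?f x))" by (rule commute_app[OF f r'])
    also have "\<dots> = comp_list (r j) \<alpha> x" using f by (simp add: inv_app)
    finally show ?thesis using x that by simp
  qed
  moreover have "?f (inv ?f x) \<in> V" using x f by (simp add: inv_app)
  moreover have "inv ?f x \<in> Y"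
    using app_mem[OF inv_mem[OF f]] x(1) openin_imp_subset[OF V(1)] by blast
  ultimately show ?thesis using \<alpha> by (intro that[of \<alpha> "inv ?f x"]) auto
qed

lemma jointly_recurrent_insert:
  assumes "finite J" and IH: "jointly_recurrent J"
  shows "jointly_recurrent (insert a J)"
  unfolding jointly_recurrent_def
proof (intro allI impI, elim conjE)
  fix w :: "'b \<Rightarrow> nat \<Rightarrow> 'a \<Rightarrow> 'a" and V and N :: nat
  assume w: "\<forall>j\<in>insert a J. \<forall>m. w j m \<in> G" and V: "openin (top_of_set Y) V" "V \<noteq> {}"
  obtain F where F: "finite F" "F \<subseteq> G" "\<forall>y\<in>Y. \<exists>g\<in>F. g y \<in> V"
    using finite_translates_cover[OF V] .
  \<comment> \<open>A state consists of an open set \<open>U\<close>, the block \<alpha> leading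
    from \<open>U\<close> to the previous open set, a translate \<open>g\<close> from
    \<open>F\<close> moving \<open>U\<close> into \<open>V\<close>, and a bound \<open>M\<close> for
    the indices used so far. \<open>P\<close> describes one state, \<open>Q\<close> a
    transition.\<close>
  define P where "P = (\<lambda>(U, \<alpha> :: nat list, g, M). openin (top_of_set Y) U \<and> U \<noteq> {} \<and> g \<in> F \<and> g ` U \<subseteq> V \<and> N \<le> M)"
  define Q where "Q = (\<lambda>(U, \<alpha> :: nat list, g :: 'a \<Rightarrow> 'a, M) (U', \<alpha>', g' :: 'a \<Rightarrow> 'a, M').
    \<alpha>' \<noteq> [] \<and> sorted_wrt (<) \<alpha>' \<and> (\<forall>m\<in>set \<alpha>'. M < m \<and> m \<le> (M'::nat)) \<and>
    (\<forall>j\<in>insert a J. comp_list (w j) \<alpha>' ` U' \<subseteq> U))"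
  have "\<exists>s. \<forall>n::nat. P (s n) \<and> Q (s n) (s (Suc n))"
  proof (rule dependent_nat_choice)
    obtain y where y: "y \<in> Y" using nonempty by blast
    then obtain g where g: "g \<in> F" "g y \<in> V" using F by blast
    \<comment> \<open>The empty list is a placeholder: the block of a state is constrained only by
      the transition into it.\<close>
    have "P ({y \<in> Y. g y \<in> V}, [], g, N)"
      using y g F V by (auto simp: P_def intro: openin_preimage)
    then show "\<exists>s. P s" by blast
  next
    fix s :: "'a set \<times> nat list \<times> ('a \<Rightarrow> 'a) \<times> nat" and n :: nat
    assume "P s"
    obtain U \<beta> h M where s: "s = (U, \<beta>, h, M)" by (cases s)
    have U: "openin (top_of_set Y) U" "U \<noteq> {}" "N \<le> M" using \<open>P s\<close> by (auto simp: P_def s)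
    obtain \<alpha> y where \<alpha>: "\<alpha> \<noteq> []" "sorted_wrt (<) \<alpha>" "\<forall>m\<in>set \<alpha>. M < m"
      and y: "y \<in> Y" "\<forall>j\<in>insert a J. comp_list (w j) \<alpha> y \<in> U"
      using common_return[OF IH w U(1,2)] .
    obtain g where g: "g \<in> F" "g y \<in> V" using F y by blast
    \<comment> \<open>By continuity, what holds at \<open>y\<close> holds on a relatively open set:
      \<open>g\<close> leads into \<open>V\<close>, and every family leads into \<open>U\<close>
      along \<alpha>.\<close>
    define U' where "U' = {y \<in> Y. g y \<in> V} \<inter> {y \<in> Y. \<forall>j\<in>insert a J. comp_list (w j) \<alpha> y \<in> U}"
    define M' where "M' = Max (set \<alpha>)"
    have "openin (top_of_set Y) U'"
      unfolding U'_def using assms(1) w g F V U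
      by (intro openin_Int openin_preimage openin_preimages comp_list_mem) auto
    moreover have "y \<in> U'" using y g by (auto simp: U'_def)
    moreover have "\<forall>m\<in>set \<alpha>. M < m \<and> m \<le> M'" using \<alpha> by (auto simp: M'_def)
    moreover have "N \<le> M'"
    proof -
      have "M' \<in> set \<alpha>" unfolding M'_def using \<alpha> by (intro Max_in) auto
      then show ?thesis using \<alpha> U by fastforce
    qed
    ultimately have "P (U', \<alpha>, g, M') \<and> Q s (U', \<alpha>, g, M')"
      using \<alpha> g by (auto simp: P_def Q_def s U'_def)
    then show "\<exists>s'. P s' \<and> Q s s'" by blast
  qed
  then obtain s where s: "\<And>n::nat. P (s n)" "\<And>n. Q (s n) (s (Suc n))" by blast
  define U where "U n = fst (s n)" for n
  define \<alpha> where "\<alpha> n = fst (snd (s n))" for n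
  define g where "g n = fst (snd (snd (s n)))" for n
  define M where "M n = snd (snd (snd (s n)))" for n
  have sn: "s n = (U n, \<alpha> n, g n, M n)" for n
    by (simp add: U_def \<alpha>_def g_def M_def)
  have P: "openin (top_of_set Y) (U n)" "U n \<noteq> {}" "g n \<in> F" "g n ` U n \<subseteq> V" "N \<le> M n" for n
    using s(1)[of n] by (auto simp: P_def sn)
  have Q: "\<alpha> (Suc n) \<noteq> []" "sorted_wrt (<) (\<alpha> (Suc n))"
    "\<forall>m\<in>set (\<alpha> (Suc n)). M n < m \<and> m \<le> M (Suc n)"
    "\<forall>j\<in>insert a J. comp_list (w j) (\<alpha> (Suc n)) ` U (Suc n) \<subseteq> U n" for n
    using s(2)[of n] by (auto simp: Q_def sn)
  \<comment> \<open>Consecutive blocks are concatenated. The outer block acts last, so the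
    composition descends from \<open>U (b + Suc d)\<close> to \<open>U b\<close>; the bounds
    \<open>M\<close> keep the concatenation increasing.\<close>
  have block: "\<exists>\<beta>. \<beta> \<noteq> [] \<and> sorted_wrt (<) \<beta> \<and> (\<forall>m\<in>set \<beta>. M b < m \<and> m \<le> M (b + Suc d)) \<and>
      (\<forall>j\<in>insert a J. comp_list (w j) \<beta> ` U (b + Suc d) \<subseteq> U b)" for b d
  proof (induction d)
    case 0
    then show ?case using Q[of b] by (intro exI[of _ "\<alpha> (Suc b)"]) auto
  next
    case (Suc d)
    then obtain \<beta> where \<beta>: "\<beta> \<noteq> []" "sorted_wrt (<) \<beta>"
      "\<forall>m\<in>set \<beta>. M b < m \<and> m \<le> M (b + Suc d)"
      "\<forall>j\<in>insert a J. comp_list (w j) \<beta> ` U (b + Suc d) \<subseteq> U b" by blast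
    let ?\<alpha> = "\<alpha> (Suc (b + Suc d))"
    note q = Q[of "b + Suc d"]
    obtain m0 where "m0 \<in> set \<beta>" using \<beta>(1) by (cases \<beta>) auto
    then have "M b < M (b + Suc d)" using \<beta>(3) by fastforce
    moreover obtain m1 where "m1 \<in> set ?\<alpha>" using q(1) by (cases ?\<alpha>) auto
    then have "M (b + Suc d) < M (Suc (b + Suc d))" using q(3) by fastforce
    ultimately have "\<forall>m\<in>set (\<beta> @ ?\<alpha>). M b < m \<and> m \<le> M (Suc (b + Suc d))"
      using \<beta>(3) q(3) by fastforce
    moreover have "sorted_wrt (<) (\<beta> @ ?\<alpha>)"
      using \<beta> q by (fastforce simp: sorted_wrt_append)
    moreover have "comp_list (w j) (\<beta> @ ?\<alpha>) ` U (Suc (b + Suc d)) \<subseteq> U b" if "j \<in> insert a J" for j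
    proof -
      have "comp_list (w j) \<beta> ` comp_list (w j) ?\<alpha> ` U (Suc (b + Suc d)) \<subseteq> comp_list (w j) \<beta> ` U (b + Suc d)"
        using q(4) that by (intro image_mono) blast
      also have "\<dots> \<subseteq> U b" using bspec[OF \<beta>(4) that] .
      finally show ?thesis by (simp only: comp_list_append image_comp)
    qed
    ultimately show ?case using \<beta>(1)
      by (intro exI[of _ "\<beta> @ ?\<alpha>"]) auto
  qed
  \<comment> \<open>Pigeonhole: infinitely many states share the finitely many translates in
    \<open>F\<close>.\<close>
  have "\<not> inj g"
    using F(1) P(3) finite_imageD[of g UNIV] finite_subset[of "range g" F] by auto
  then obtain b c where "g b = g c" "b < c"
    unfolding inj_on_def by (metis linorder_neqE_nat)
  then obtain d where d: "g b = g (b + Suc d)" by (metis less_iff_Suc_add add_Suc_right)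
  obtain \<beta> where \<beta>: "\<beta> \<noteq> []" "sorted_wrt (<) \<beta>" "\<forall>m\<in>set \<beta>. M b < m"
    "\<forall>j\<in>insert a J. comp_list (w j) \<beta> ` U (b + Suc d) \<subseteq> U b" using block[of b d] by blast
  obtain z where z: "z \<in> U (b + Suc d)" using P by blast
  \<comment> \<open>The returning point is \<open>g b z\<close>. It lies in \<open>V\<close> because
    \<open>g b\<close> is also the translate of the later set; its images do because
    \<open>g b\<close> commutes past the product, which moves \<open>z\<close> into
    \<open>U b\<close>.\<close>
  have "comp_list (w j) \<beta> (g b z) \<in> V" if j: "j \<in> insert a J" for j
  proof -
    have "comp_list (w j) \<beta> \<in> G" using w j by (intro comp_list_mem) auto
    moreover have "g b \<in> G" using P F by blast
    ultimately have "comp_list (w j) \<beta> (g b z) = g b (comp_list (w j) \<beta> z)" by (rule commute_app)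
    moreover have "comp_list (w j) \<beta> z \<in> U b" using bspec[OF \<beta>(4) j] z by (rule subsetD[OF _ imageI])
    ultimately show ?thesis using P(4)[of b] by auto
  qed
  moreover have "g b z \<in> V" using P(4)[of "b + Suc d"] z d by auto
  moreover have "\<forall>m\<in>set \<beta>. N < m" using \<beta>(3) P(5)[of b] by auto
  ultimately show "\<exists>\<alpha>. \<alpha> \<noteq> [] \<and> sorted_wrt (<) \<alpha> \<and> (\<forall>m\<in>set \<alpha>. N < m) \<and>
           (\<exists>x\<in>V. \<forall>j\<in>insert a J. comp_list (w j) \<alpha> x \<in> V)"
    using \<beta> by (intro exI[of _ \<beta>]) blast
qed

lemma jointly_recurrent_finite: "finite J \<Longrightarrow> jointly_recurrent J"
  by (induction J rule: finite_induct) (auto intro: jointly_recurrent_empty jointly_recurrent_insert)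

section \<open>From returns to open sets to one recurrent point\<close>

lemma jointly_recurrent_point:
  assumes J: "finite J" and w: "\<forall>j\<in>J. \<forall>m::nat. w j m \<in> G"
  obtains x \<alpha> where "x \<in> Y"
    "\<And>n. \<alpha> n \<noteq> []" "\<And>n. sorted_wrt (<) (\<alpha> n)" "\<And>n m. m \<in> set (\<alpha> n) \<Longrightarrow> N < m"
    "\<And>n m m'. m \<in> set (\<alpha> n) \<Longrightarrow> m' \<in> set (\<alpha> (Suc n)) \<Longrightarrow> m < m'"
    "\<And>j. j \<in> J \<Longrightarrow> (\<lambda>n. comp_list (w j) (\<alpha> n) x) \<longlonglongrightarrow> x"
proof -
  \<comment> \<open>Closed balls relative to \<open>Y\<close> are compact, so a nested sequence of
    them has a common point; the estimates in \<open>Q\<close> hold on the whole ball and hence at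
    that point.\<close>
  define C where "C z \<delta> = cball z \<delta> \<inter> Y" for z and \<delta> :: real
  define P where "P = (\<lambda>(z, \<delta>::real, \<alpha> :: nat list, M). z \<in> Y \<and> 0 < \<delta> \<and> \<alpha> \<noteq> [] \<and> sorted_wrt (<) \<alpha> \<and>
     (\<forall>m\<in>set \<alpha>. N < m \<and> m \<le> M) \<and> N \<le> M)"
  define Q where "Q n = (\<lambda>(z, \<delta>, \<alpha> :: nat list, M :: nat) (z', \<delta>', \<alpha>', M' :: nat). C z' \<delta>' \<subseteq> C z \<delta> \<and>
     (\<forall>m\<in>set \<alpha>'. M < m) \<and>
     (\<forall>x\<in>C z' \<delta>'. \<forall>j\<in>J. dist (comp_list (w j) \<alpha>' x) x < 1 / real (Suc n)))" for n
  have "\<exists>s. \<forall>n::nat. P (s n) \<and> Q n (s n) (s (Suc n))"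
  proof (rule dependent_nat_choice)
    obtain y where "y \<in> Y" using nonempty by blast
    then have "P (y, 1, [Suc N], Suc N)" by (simp add: P_def)
    then show "\<exists>s. P s" by blast
  next
    fix s n
    assume "P s"
    obtain z \<delta> \<beta> M where s: "s = (z, \<delta>, \<beta>, M)" by (cases s)
    have z: "z \<in> Y" "0 < \<delta>" "N \<le> M" using \<open>P s\<close> by (auto simp: P_def s)
    \<comment> \<open>A point and its image that both lie within \<epsilon> of \<open>z\<close> are
      less than \<open>1 / Suc n\<close> apart.\<close>
    define \<epsilon> where "\<epsilon> = min \<delta> (1 / (2 * real (Suc n)))"
    define V where "V = ball z \<epsilon> \<inter> Y"
    have \<epsilon>: "0 < \<epsilon>" "\<epsilon> \<le> \<delta>" "\<epsilon> + \<epsilon> \<le> 1 / real (Suc n)"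
      using z by (auto simp: \<epsilon>_def min_def field_simps)
    have V: "openin (top_of_set Y) V" "V \<noteq> {}"
      using \<epsilon> z by (auto simp: V_def Int_commute[of _ Y] openin_open_Int)
    obtain \<alpha> x where \<alpha>: "\<alpha> \<noteq> []" "sorted_wrt (<) \<alpha>" "\<forall>m\<in>set \<alpha>. M < m"
      and x: "x \<in> V" "\<forall>j\<in>J. comp_list (w j) \<alpha> x \<in> V"
      using jointly_recurrentE[where N = M, OF jointly_recurrent_finite[OF J] w V] .
    have "openin (top_of_set Y) (V \<inter> {y \<in> Y. \<forall>j\<in>J. comp_list (w j) \<alpha> y \<in> V})" (is "openin _ ?U")
      using J w V by (intro openin_Int openin_preimages comp_list_mem) auto
    moreover have "x \<in> ?U" using x by (auto simp: V_def)
    ultimately obtain \<eta> where \<eta>: "0 < \<eta>" "C x \<eta> \<subseteq> ?U"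
      unfolding openin_contains_cball C_def by blast
    have "dist (comp_list (w j) \<alpha> y) y < 1 / real (Suc n)" if "y \<in> C x \<eta>" "j \<in> J" for y j
    proof -
      have "dist z y < \<epsilon>" "dist z (comp_list (w j) \<alpha> y) < \<epsilon>"
        using that \<eta>(2) by (auto simp: V_def)
      then show ?thesis using \<epsilon>(3) dist_triangle3[of "comp_list (w j) \<alpha> y" y z] by linarith
    qed
    moreover have "C x \<eta> \<subseteq> C z \<delta>" using \<eta>(2) \<epsilon>(2) by (auto simp: C_def V_def)
    moreover have "\<exists>M'. N \<le> M' \<and> (\<forall>m\<in>set \<alpha>. m \<le> M')"
      by (intro exI[of _ "Max (insert N (set \<alpha>))"]) auto
    ultimately obtain M' where "P (x, \<eta>, \<alpha>, M') \<and> Q n s (x, \<eta>, \<alpha>, M')"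
      using \<alpha> \<eta>(1) x(1) z(3) by (fastforce simp: P_def Q_def s V_def)
    then show "\<exists>s'. P s' \<and> Q n s s'" by blast
  qed
  then obtain s where s: "\<And>n::nat. P (s n)" "\<And>n. Q n (s n) (s (Suc n))" by blast
  define z where "z n = fst (s n)" for n
  define \<delta> where "\<delta> n = fst (snd (s n))" for n
  define \<alpha> where "\<alpha> n = fst (snd (snd (s n)))" for n
  define M where "M n = snd (snd (snd (s n)))" for n
  have sn: "s n = (z n, \<delta> n, \<alpha> n, M n)" for n
    by (simp add: z_def \<alpha>_def \<delta>_def M_def)
  have P: "z n \<in> Y" "0 < \<delta> n" "\<alpha> n \<noteq> []" "sorted_wrt (<) (\<alpha> n)" "\<forall>m\<in>set (\<alpha> n). N < m \<and> m \<le> M n" for n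
    using s(1)[of n] by (auto simp: P_def sn)
  have Q: "C (z (Suc n)) (\<delta> (Suc n)) \<subseteq> C (z n) (\<delta> n)" "\<forall>m\<in>set (\<alpha> (Suc n)). M n < m"
    "\<forall>x\<in>C (z (Suc n)) (\<delta> (Suc n)). \<forall>j\<in>J. dist (comp_list (w j) (\<alpha> (Suc n)) x) x < 1 / real (Suc n)" for n
    using s(2)[of n] by (auto simp: Q_def sn)
  define K where "K n = C (z n) (\<delta> n)" for n
  have dec: "K m \<subseteq> K n" if "n \<le> m" for m n
    using lift_Suc_antimono_le[of K, OF _ that] Q(1) by (simp add: K_def)
  have "Y \<inter> (\<Inter>n\<in>UNIV. K n) \<noteq> {}"
  proof (rule compact_imp_fip_image[OF compact])
    show "closed (K n)" for n
      by (auto simp: K_def C_def intro!: closed_Int compact_imp_closed[OF compact])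
    fix I :: "nat set" assume "finite I"
    \<comment> \<open>The centre of the last ball lies in all earlier ones; inserting 0 gives the
      maximum a meaning for empty \<open>I\<close>.\<close>
    have "z (Max (insert 0 I)) \<in> K n" if "n \<in> I" for n
    proof -
      have "z (Max (insert 0 I)) \<in> K (Max (insert 0 I))"
        using P(1,2)[of "Max (insert 0 I)"] by (simp add: K_def C_def)
      then show ?thesis using dec[of n "Max (insert 0 I)"] that \<open>finite I\<close> by auto
    qed
    then show "Y \<inter> (\<Inter>n\<in>I. K n) \<noteq> {}" using P(1) by blast
  qed
  then obtain x where x: "x \<in> Y" "\<And>n. x \<in> K n" by blast
  show ?thesis
  proof (rule that[of x \<alpha>])
    show "m < m'" if "m \<in> set (\<alpha> n)" "m' \<in> set (\<alpha> (Suc n))" for n m m'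
      using that P(5)[of n] Q(2)[of n] by fastforce
    fix j assume j: "j \<in> J"
    \<comment> \<open>The block at index 0 comes from the initial state and carries no estimate, so
      convergence is shown for the shifted sequence.\<close>
    have "(\<lambda>n. dist (comp_list (w j) (\<alpha> (Suc n)) x) x) \<longlonglongrightarrow> 0"
    proof (rule tendsto_sandwich[OF _ _ tendsto_const LIMSEQ_Suc[OF lim_inverse_n']])
      show "\<forall>\<^sub>F n in sequentially. dist (comp_list (w j) (\<alpha> (Suc n)) x) x \<le> 1 / real (Suc n)"
        using Q(3) x(2) j by (intro always_eventually allI less_imp_le) (auto simp: K_def)
    qed simp
    then have "(\<lambda>n. comp_list (w j) (\<alpha> (Suc n)) x) \<longlonglongrightarrow> x"
      by (subst tendsto_dist_iff)
    then show "(\<lambda>n. comp_list (w j) (\<alpha> n) x) \<longlonglongrightarrow> x"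
      by (rule LIMSEQ_imp_Suc)
  qed (use x P in auto)
qed

end

section \<open>The group generated by commuting homeomorphisms\<close>

inductive_set homeo_closure :: "('a \<Rightarrow> 'a) set \<Rightarrow> ('a \<Rightarrow> 'a) set" for S where
  gen: "f \<in> S \<Longrightarrow> f \<in> homeo_closure S"
| id: "id \<in> homeo_closure S"
| comp: "f \<in> homeo_closure S \<Longrightarrow> g \<in> homeo_closure S \<Longrightarrow> f \<circ> g \<in> homeo_closure S"
| inv: "f \<in> homeo_closure S \<Longrightarrow> inv f \<in> homeo_closure S"

lemma inv_commute:
  assumes "bij f" "f \<circ> h = h \<circ> f"
  shows "inv f \<circ> h = h \<circ> inv f"
proof
  fix x
  have "h x = h (f (inv f x))" using assms(1) by (simp add: bij_is_surj surj_f_inv_f)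
  also have "\<dots> = f (h (inv f x))" using fun_cong[OF assms(2)] by simp
  finally show "(inv f \<circ> h) x = (h \<circ> inv f) x"
    using assms(1) by (simp add: bij_is_inj)
qed

lemma commuting_homeos_homeo_closure:
  fixes X :: "'a::metric_space set"
  assumes X: "compact X" "X \<noteq> {}"
    and S: "\<And>f. f \<in> S \<Longrightarrow> bij f" "\<And>f. f \<in> S \<Longrightarrow> f ` X = X"
      "\<And>f. f \<in> S \<Longrightarrow> continuous_on X f" "\<And>f. f \<in> S \<Longrightarrow> continuous_on X (inv f)"
    and commute: "\<And>f g. f \<in> S \<Longrightarrow> g \<in> S \<Longrightarrow> f \<circ> g = g \<circ> f"
  shows "commuting_homeos X (homeo_closure S)"
proof -
  \<comment> \<open>Continuity of the inverse is carried through the induction, since it is what the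
    inverse case asks for.\<close>
  have H: "bij f \<and> f ` X = X \<and> continuous_on X f \<and> continuous_on X (inv f)"
    if "f \<in> homeo_closure S" for f
    using that
  proof induction
    case (comp f g)
    then have inv: "inv f ` X = X" by (metis bij_is_inj image_inv_f_f)
    have "inv (f \<circ> g) = inv g \<circ> inv f" using comp by (simp add: o_inv_distrib)
    moreover have "continuous_on X (f \<circ> g)" using comp by (intro continuous_on_compose) simp_all
    moreover have "continuous_on X (inv g \<circ> inv f)" using comp inv by (intro continuous_on_compose) simp_all
    moreover have "(f \<circ> g) ` X = X" using comp by (simp only: image_comp[symmetric])
    moreover have "bij (f \<circ> g)" using comp by (intro bij_comp) simp_all
    ultimately show ?case by (simp only: simp_thms)
  next
    case (inv f)
    then have "inv f ` X = X" by (metis bij_is_inj image_inv_f_f)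
    then show ?case using inv by (simp add: bij_imp_bij_inv inv_inv_eq)
  next
    case id
    show ?case by (intro conjI bij_id) (auto simp: inv_id)
  qed (use S in auto)
  \<comment> \<open>Commutation is extended one factor at a time: first against a generator, then
    against any element, where this fact with exchanged roles is the generator case.\<close>
  have SG: "f \<circ> g = g \<circ> f" if "f \<in> homeo_closure S" "g \<in> S" for f g
    using that(1)
  proof induction
    case (comp f h)
    have "f \<circ> h \<circ> g = f \<circ> (g \<circ> h)" using comp.IH(2) by (simp only: comp_assoc)
    also have "\<dots> = (g \<circ> f) \<circ> h" using comp.IH(1) by (simp only: comp_assoc[symmetric])
    finally show ?case by (simp only: comp_assoc)
  next
    case (inv f)
    then show ?case using inv_commute H by blast
  qed (use commute that in auto)
  have GG: "f \<circ> g = g \<circ> f" if "f \<in> homeo_closure S" "g \<in> homeo_closure S" for f g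
    using that(1)
  proof induction
    case (gen f)
    then show ?case using SG[OF that(2), of f] by simp
  next
    case (comp f h)
    have "f \<circ> h \<circ> g = f \<circ> (g \<circ> h)" using comp.IH(2) by (simp only: comp_assoc)
    also have "\<dots> = (g \<circ> f) \<circ> h" using comp.IH(1) by (simp only: comp_assoc[symmetric])
    finally show ?case by (simp only: comp_assoc)
  next
    case (inv f)
    then show ?case using inv_commute H by blast
  qed simp
  show ?thesis
    by standard (use X H GG in \<open>auto intro: homeo_closure.intros simp del: o_apply\<close>)
qed

text \<open>Used to pass from the increasing order of positions in \<open>rational_family\<close> to
  the order in which \<open>-m\<close> and \<open>m\<close> stand side by side.\<close>

lemma comp_list_mset_eq:
  assumes "mset xs = mset ys"
    and "\<And>s t. s \<in> set xs \<Longrightarrow> t \<in> set xs \<Longrightarrow> w s \<circ> w t = w t \<circ> w s"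
  shows "comp_list w xs = comp_list w ys"
  unfolding comp_list_def foldr_conv_fold
proof (rule fold_permuted_eq[where P = "\<lambda>_. True"])
  show "w s \<circ> (w t \<circ> f) = w t \<circ> (w s \<circ> f)" if "s \<in> set (rev xs)" "t \<in> set (rev xs)" for s t f
    using assms(2)[of s t] that by (simp add: comp_assoc[symmetric])
qed (use assms(1) in auto)

lemma comp_list_filter:
  "(\<And>t. t \<in> set xs \<Longrightarrow> \<not> P t \<Longrightarrow> w t = id) \<Longrightarrow> comp_list w (filter P xs) = comp_list w xs"
  by (induction xs) auto

section \<open>Rationals with constant digits on a block\<close>

text \<open>The rational with digit 1 exactly at the positions \<open>-m\<close> for
  \<open>m\<close> in \<open>A\<close>, when \<open>A\<close> is a finite set of positive integers;
  \<open>int_block\<close> is its counterpart at the positions \<open>m\<close>.\<close>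

definition frac_block :: "nat set \<Rightarrow> rat" where
  "frac_block A = (\<Sum>m\<in>A. (- 1) ^ m / fact (m + 1))"

definition int_block :: "nat set \<Rightarrow> int" where
  "int_block A = (\<Sum>m\<in>A. (- 1) ^ (m + 1) * fact m)"

definition block_digit :: "nat set \<Rightarrow> nat \<Rightarrow> nat \<Rightarrow> int \<Rightarrow> nat" where
  "block_digit A p q t =
     (if t < 0 \<and> nat (- t) \<in> A then p else if 0 < t \<and> nat t \<in> A then q else 0)"

text \<open>As \<open>p\<close> and \<open>q\<close> do not exceed any position in \<open>A\<close>,
  they are admissible digits there. The defining sum is then already an expansion, and uniqueness
  identifies it.\<close>

lemma rat_digit_block:
  assumes A: "finite A" "\<And>m. m \<in> A \<Longrightarrow> 1 \<le> m \<and> p \<le> m \<and> q \<le> m"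
  shows "rat_digit (of_nat p * frac_block A + of_nat q * of_int (int_block A)) = block_digit A p q"
proof -
  let ?d = "block_digit A p q"
  have neg: "?d (- int s) = (if s \<in> A then p else 0)" if "s \<ge> 1" for s
    using that by (auto simp: block_digit_def)
  have pos: "?d (int s) = (if s \<in> A then q else 0)" if "s \<ge> 1" for s
    using that by (auto simp: block_digit_def)
  have "{t. ?d t \<noteq> 0} \<subseteq> (\<lambda>m. - int m) ` A \<union> int ` A"
  proof
    fix t assume "t \<in> {t. ?d t \<noteq> 0}"
    then have "t = - int (nat (- t)) \<and> nat (- t) \<in> A \<or> t = int (nat t) \<and> nat t \<in> A"
      by (auto simp: block_digit_def split: if_splits)
    then show "t \<in> (\<lambda>m. - int m) ` A \<union> int ` A" by blast
  qed
  then have fin: "finite {t. ?d t \<noteq> 0}" by (rule finite_subset) (use A in auto)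
  have "(\<Sum>s | s \<ge> 1 \<and> ?d (- int s) \<noteq> 0. of_nat (?d (- int s)) * ((- 1) ^ s / fact (s + 1)))
      = (\<Sum>s\<in>A. of_nat p * ((- 1) ^ s / fact (s + 1)) :: rat)"
    by (rule sum.mono_neutral_cong_left) (use A neg in \<open>auto split: if_splits\<close>)
  moreover have "(\<Sum>r | r \<ge> 1 \<and> ?d (int r) \<noteq> 0. of_nat (?d (int r)) * ((- 1) ^ (r + 1) * fact r))
      = (\<Sum>r\<in>A. of_nat q * ((- 1) ^ (r + 1) * fact r) :: rat)"
    by (rule sum.mono_neutral_cong_left) (use A pos in \<open>auto split: if_splits\<close>)
  ultimately have "is_rat_expansion (of_nat p * frac_block A + of_nat q * of_int (int_block A)) ?d"
    using A fin neg pos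
    by (simp add: is_rat_expansion_def frac_block_def int_block_def sum_distrib_left block_digit_def)
  then show ?thesis using is_rat_expansion_rat_digit rat_expansion_unique by blast
qed

lemma rdom_block:
  assumes "finite A" "\<And>m. m \<in> A \<Longrightarrow> 1 \<le> m \<and> p \<le> m \<and> q \<le> m"
  shows "rdom_neg (of_nat p * frac_block A + of_nat q * of_int (int_block A))
           = (if p = 0 then {} else (\<lambda>m. - int m) ` A)" (is ?neg)
    and "rdom_pos (of_nat p * frac_block A + of_nat q * of_int (int_block A))
           = (if q = 0 then {} else int ` A)" (is ?pos)
proof -
  have "t \<in> (\<lambda>m. - int m) ` A" if "t < 0" "nat (- t) \<in> A" for t
    using that by (intro image_eqI[of _ _ "nat (- t)"]) auto
  then show ?neg using assms(2)
    by (fastforce simp: rdom_neg_def rdom_def rat_digit_block[OF assms] block_digit_def split: if_splits)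
  have "t \<in> int ` A" if "0 < t" "nat t \<in> A" for t
    using that by (intro image_eqI[of _ _ "nat t"]) auto
  then show ?pos using assms(2)
    by (fastforce simp: rdom_pos_def rdom_def rat_digit_block[OF assms] block_digit_def split: if_splits)
qed

text \<open>An integer value would satisfy the hypotheses of \<open>frac_expansion_unique\<close>
  with coefficient 1 on \<open>A\<close> and 0 elsewhere, forcing even the coefficient at
  \<open>Max A\<close> to vanish.\<close>

lemma frac_block_not_Ints:
  assumes "finite A" "A \<noteq> {}" "\<And>m. m \<in> A \<Longrightarrow> 1 \<le> m"
  shows "frac_block A \<notin> \<int>"
proof
  assume "frac_block A \<in> \<int>"
  then obtain z where z: "frac_block A = of_int z" by (elim Ints_cases)
  define c :: "nat \<Rightarrow> int" where "c s = (if s \<in> A then 1 else 0)" for s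
  have "(\<Sum>s=1..Max A. of_int (c s) * ((- 1) ^ s / fact (s + 1)) :: rat) = of_int z"
    unfolding z[symmetric] frac_block_def
    by (rule sum.mono_neutral_cong_right) (use assms in \<open>auto simp: c_def\<close>)
  moreover have "\<bar>c s\<bar> \<le> int s" for s
    using assms(3)[of s] by (auto simp: c_def)
  ultimately have "\<forall>s\<in>{1..Max A}. c s = 0" by (intro frac_expansion_unique)
  moreover have "Max A \<in> {1..Max A}" "c (Max A) = 1"
    using assms by (auto simp: c_def)
  ultimately show False by simp
qed

lemma rational_family_block:
  assumes U: "\<And>s t. U s \<circ> U t = U t \<circ> U s"
    and \<alpha>: "distinct \<alpha>" "\<And>m. m \<in> set \<alpha> \<Longrightarrow> 1 \<le> m \<and> p \<le> m \<and> q \<le> m"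
  shows "rational_family U (of_nat p * frac_block (set \<alpha>) + of_nat q * of_int (int_block (set \<alpha>)))
    = comp_list (\<lambda>m. U (- int m) ^^ p \<circ> U (int m) ^^ q) \<alpha>"
proof -
  let ?q = "of_nat p * frac_block (set \<alpha>) + of_nat q * of_int (int_block (set \<alpha>)) :: rat"
  let ?d = "block_digit (set \<alpha>) p q"
  let ?w = "\<lambda>t. U t ^^ ?d t"
  \<comment> \<open>This list pairs the positions \<open>-m\<close> and \<open>m\<close>. Once the
    positions with digit 0 are dropped (as happens for \<open>p = 0\<close> or
    \<open>q = 0\<close>), it is a permutation of the domain; they act as the identity and are
    restored afterwards.\<close>
  let ?l = "concat (map (\<lambda>m. [- int m, int m]) \<alpha>)"
  have d: "rat_digit ?q = ?d" using \<alpha>(2) by (intro rat_digit_block) auto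
  have pow: "U s ^^ m \<circ> U t ^^ n = U t ^^ n \<circ> U s ^^ m" for s t m n
  proof -
    have 1: "U s \<circ> U t ^^ n = U t ^^ n \<circ> U s" for n
    proof (induction n)
      case (Suc n)
      have "U s \<circ> U t ^^ Suc n = (U s \<circ> U t) \<circ> U t ^^ n" by (simp only: comp_assoc funpow.simps)
      also have "\<dots> = U t \<circ> (U s \<circ> U t ^^ n)" by (simp only: U[of s t] comp_assoc)
      also have "\<dots> = U t ^^ Suc n \<circ> U s" by (simp only: Suc comp_assoc funpow.simps)
      finally show ?case .
    qed simp
    show ?thesis
    proof (induction m)
      case (Suc m)
      have "U s ^^ Suc m \<circ> U t ^^ n = U s \<circ> (U s ^^ m \<circ> U t ^^ n)" by (simp only: comp_assoc funpow.simps)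
      also have "\<dots> = (U s \<circ> U t ^^ n) \<circ> U s ^^ m" by (simp only: Suc comp_assoc)
      also have "\<dots> = U t ^^ n \<circ> U s ^^ Suc m" by (simp only: 1 comp_assoc funpow.simps)
      finally show ?case .
    qed simp
  qed
  have l: "set ?l = (\<lambda>m. - int m) ` set \<alpha> \<union> int ` set \<alpha>" by auto
  have "distinct ?l" using \<alpha>
  proof (induction \<alpha>)
    case (Cons m \<alpha>)
    then show ?case by (fastforce simp: image_iff)
  qed simp
  moreover have "{t. t \<noteq> 0 \<and> ?d t \<noteq> 0} = {t \<in> set ?l. ?d t \<noteq> 0}"
  proof -
    have "t \<in> set ?l" if "?d t \<noteq> 0" for t
    proof -
      have "t = - int (nat (- t)) \<and> nat (- t) \<in> set \<alpha> \<or> t = int (nat t) \<and> nat t \<in> set \<alpha>"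
        using that by (auto simp: block_digit_def split: if_splits)
      then show ?thesis unfolding l by blast
    qed
    moreover have "?d 0 = 0" by (simp add: block_digit_def)
    ultimately show ?thesis by blast
  qed
  ultimately have "mset (sorted_list_of_set (rdom ?q)) = mset (filter (\<lambda>t. ?d t \<noteq> 0) ?l)"
    by (subst set_eq_iff_mset_eq_distinct[symmetric]) (simp_all add: finite_rdom, simp add: rdom_def d)
  then have "rational_family U ?q = comp_list ?w (filter (\<lambda>t. ?d t \<noteq> 0) ?l)"
    unfolding rational_family_def d comp_list_def[symmetric]
    by (rule comp_list_mset_eq) (rule pow)
  also have "\<dots> = comp_list ?w ?l" by (rule comp_list_filter) simp
  also have "\<dots> = comp_list (\<lambda>m. U (- int m) ^^ p \<circ> U (int m) ^^ q) \<alpha>"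
  proof -
    have "?d (- int m) = p \<and> ?d (int m) = q" if "m \<in> set \<alpha>" for m
      using that \<alpha>(2) by (fastforce simp: block_digit_def)
    \<comment> \<open>The induction runs over a separate list \<beta>, so that the digit function,
      which depends on \<alpha>, stays fixed.\<close>
    then have "set \<beta> \<subseteq> set \<alpha> \<Longrightarrow> comp_list ?w (concat (map (\<lambda>m. [- int m, int m]) \<beta>))
        = comp_list (\<lambda>m. U (- int m) ^^ p \<circ> U (int m) ^^ q) \<beta>" for \<beta>
      by (induction \<beta>) (simp_all add: comp_assoc)
    then show ?thesis by blast
  qed
  finally show ?thesis .
qed

section \<open>From maps on \<open>X\<close> to bijections of the whole type\<close>

text \<open>Every partial product keeps the point in \<open>X\<close>, where the maps agree, and
  position 0 never occurs in a domain.\<close>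

lemma rational_family_cong:
  assumes "\<And>t x. t \<noteq> 0 \<Longrightarrow> x \<in> X \<Longrightarrow> T t x \<in> X \<and> U t x = T t x" "x \<in> X"
  shows "rational_family U q x = rational_family T q x"
proof -
  have pow: "(T t ^^ n) y \<in> X \<and> (U t ^^ n) y = (T t ^^ n) y" if "t \<noteq> 0" "y \<in> X" for t n y
    using assms(1)[OF that(1)] that(2) by (induction n) auto
  have "comp_list (\<lambda>t. T t ^^ d t) xs x \<in> X \<and>
      comp_list (\<lambda>t. U t ^^ d t) xs x = comp_list (\<lambda>t. T t ^^ d t) xs x" if "0 \<notin> set xs" for d xs
    using that pow assms(2) by (induction xs) auto
  then have "comp_list (\<lambda>t. U t ^^ rat_digit q t) (sorted_list_of_set (rdom q)) x
      = comp_list (\<lambda>t. T t ^^ rat_digit q t) (sorted_list_of_set (rdom q)) x"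
    using finite_rdom[of q] by (auto simp: rdom_def)
  then show ?thesis by (simp add: rational_family_def comp_list_def)
qed

text \<open>
  Extending the given maps by the identity outside \<open>X\<close> makes them bijections that commute as
  functions on the whole type, so that group identities need no restriction to \<open>X\<close>.
\<close>

lemma homeomorphism_extend_by_id:
  assumes "homeomorphism X X f g"
  defines "F \<equiv> \<lambda>x. if x \<in> X then f x else x"
  shows "bij F" "F ` X = X" "continuous_on X F" "continuous_on X (inv F)"
proof -
  define H where "H = (\<lambda>x. if x \<in> X then g x else x)"
  have X: "f x \<in> X" "g x \<in> X" "g (f x) = x" "f (g x) = x" if "x \<in> X" for x
    using assms(1) that by (auto simp: homeomorphism_def)
  have FH: "F \<circ> H = id" "H \<circ> F = id" by (auto simp: F_def H_def X fun_eq_iff)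
  then show "bij F" by (metis o_bij)
  have "inv F = H" using FH by (rule inv_unique_comp)
  moreover have "continuous_on X H" "continuous_on X F"
    using homeomorphism_cont1[OF assms(1)] homeomorphism_cont2[OF assms(1)]
    by (simp_all add: F_def H_def cong: continuous_on_cong)
  ultimately show "continuous_on X F" "continuous_on X (inv F)" by simp_all
  have "F ` X = f ` X" by (intro image_cong) (auto simp: F_def)
  then show "F ` X = X" using homeomorphism_image1[OF assms(1)] by simp
qed

lemma rational_dynamical_system_extension:
  fixes X :: "'a::metric_space set"
  assumes "rational_dynamical_system X l \<T>"
  obtains G U where "commuting_homeos X G" "\<forall>i n. U i n \<in> G"
    "\<forall>i\<in>{1..l}. \<forall>q. \<forall>x\<in>X. \<T> i q x = rational_family (U i) q x"
proof -
  from assms obtain T :: "nat \<Rightarrow> int \<Rightarrow> 'a \<Rightarrow> 'a" where X: "X \<noteq> {}" "compact X"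
    and hom: "\<forall>i\<in>{1..l}. \<forall>n. n \<noteq> 0 \<longrightarrow> (\<exists>S. homeomorphism X X (T i n) S)"
    and com: "\<forall>i\<in>{1..l}. \<forall>j\<in>{1..l}. \<forall>m n. m \<noteq> 0 \<longrightarrow> n \<noteq> 0 \<longrightarrow>
           (\<forall>x\<in>X. T i m (T j n x) = T j n (T i m x))"
    and fam: "\<forall>i\<in>{1..l}. \<forall>q. \<forall>x\<in>X. \<T> i q x = rational_family (T i) q x"
    unfolding rational_dynamical_system_def by (elim conjE exE)
  \<comment> \<open>The identity is the default at position 0 and for family indices outside
    \<open>1..l\<close>, so that the homeomorphism and commutation properties hold for all
    indices.\<close>
  define T' where "T' i n = (if i \<in> {1..l} \<and> n \<noteq> 0 then T i n else id)" for i n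
  define U where "U i n x = (if x \<in> X then T' i n x else x)" for i n x
  have hom': "\<exists>g. homeomorphism X X (T' i n) g" for i n
  proof (cases "i \<in> {1..l} \<and> n \<noteq> 0")
    case False
    then have "T' i n = id" unfolding T'_def by (rule if_not_P)
    moreover have "homeomorphism X X id id" unfolding id_def by (rule homeomorphism_ident)
    ultimately show ?thesis by auto
  qed (use hom in \<open>simp add: T'_def\<close>)
  have mem: "T' i n x \<in> X" if "x \<in> X" for i n x
    using hom'[of i n] homeomorphism_image1 that by blast
  have com': "T' i m (T' j n x) = T' j n (T' i m x)" if "x \<in> X" for i j m n x
    using com that unfolding T'_def by simp
  have Ueq: "U i n = (\<lambda>x. if x \<in> X then T' i n x else x)" for i n
    by (rule ext) (rule U_def)
  have "commuting_homeos X (homeo_closure (range (case_prod U)))"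
  proof (rule commuting_homeos_homeo_closure[OF X(2,1)])
    fix f assume "f \<in> range (case_prod U)"
    then obtain i n where f: "f = U i n" by auto
    obtain g where "homeomorphism X X (T' i n) g" using hom' by blast
    note * = homeomorphism_extend_by_id[OF this, folded Ueq, folded f]
    show "bij f" "f ` X = X" "continuous_on X f" "continuous_on X (inv f)" by (fact *)+
    fix h assume "h \<in> range (case_prod U)"
    then obtain j m where h: "h = U j m" by auto
    show "f \<circ> h = h \<circ> f"
      unfolding f h by (rule ext) (simp add: U_def mem com')
  qed
  moreover have "U i n \<in> homeo_closure (range (case_prod U))" for i n
    by (rule homeo_closure.gen) (rule range_eqI[of _ _ "(i, n)"], simp)
  moreover have "\<T> i q x = rational_family (U i) q x" if "i \<in> {1..l}" "x \<in> X" for i q x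
  proof -
    have "rational_family (U i) q x = rational_family (T i) q x"
    proof (rule rational_family_cong)
      show "T i t y \<in> X \<and> U i t y = T i t y" if "t \<noteq> 0" "y \<in> X" for t y
        using mem[OF that(2), of i t] that \<open>i \<in> {1..l}\<close> by (simp add: U_def T'_def)
    qed fact
    then show ?thesis using fam that by simp
  qed
  ultimately show ?thesis by (intro that[of _ U] allI ballI)
qed

section \<open>Construction of the recurrent point and the sequences \<beta> and \<gamma>\<close>

theorem theorem4p1:
  fixes X :: "'a::metric_space set"
    and \<T> :: "nat \<Rightarrow> rat \<Rightarrow> 'a \<Rightarrow> 'a"
    and l k :: nat
    and k1 k2 :: real
  assumes "l \<ge> 1"
    and "rational_dynamical_system X l \<T>"
    and "k \<ge> 1"
    and "k1 < k2"
  shows "\<exists>x\<in>X. \<exists>(\<beta> :: nat \<Rightarrow> rat) (\<gamma> :: nat \<Rightarrow> int).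
     (\<forall>n\<ge>1. \<beta> n \<notin> \<int> \<and> \<gamma> n \<noteq> 0 \<and>
        rdom_pos (\<beta> n) = {} \<and> rdom_neg (of_int (\<gamma> n)) = {} \<and>
        \<beta> n + of_int (\<gamma> n) \<prec> \<beta> (n + 1) + of_int (\<gamma> (n + 1))) \<and>
     real_of_int (Max (rdom_neg (\<beta> 1))) < k1 \<and>
     k2 < real_of_int (Min (rdom_pos (of_int (\<gamma> 1)))) \<and>
     (\<forall>i\<in>{1..l}. \<forall>p q :: int. 0 \<le> p \<and> p \<le> int k \<and> 0 \<le> q \<and> q \<le> int k \<longrightarrow>
        (\<lambda>n. \<T> i (of_int p * \<beta> n + of_int q * of_int (\<gamma> n)) x) \<longlonglongrightarrow> x)"
proof -
  obtain G U where G: "commuting_homeos X G" and U: "\<forall>i n. U i n \<in> G"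
    and fam: "\<forall>i\<in>{1..l}. \<forall>q. \<forall>x\<in>X. \<T> i q x = rational_family (U i) q x"
    using rational_dynamical_system_extension[OF assms(2)] .
  interpret commuting_homeos X G by (fact G)
  obtain Y where Y: "Y \<subseteq> X" "minimal_commuting_homeos Y G"
    using minimal_subset_exists by blast
  interpret M: minimal_commuting_homeos Y G by (fact Y)
  define J where "J = {1..l} \<times> {..k} \<times> {..k}"
  define w where "w = (\<lambda>(i, p, q) m. U i (- int m) ^^ p \<circ> U i (int m) ^^ q)"
  \<comment> \<open>Positions beyond \<open>N\<close> exceed \<open>k\<close>, so digits up to
    \<open>k\<close> are admissible, and exceed \<bar>k1\<bar> + \<bar>k2\<bar>, which clears both
    real bounds.\<close>
  define N where "N = nat \<lceil>\<bar>k1\<bar> + \<bar>k2\<bar>\<rceil> + k"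
  have w: "\<forall>j\<in>J. \<forall>m. w j m \<in> G"
    by (auto simp: w_def J_def simp del: o_apply intro!: comp_mem funpow_mem U[rule_format])
  have J: "finite J" by (simp add: J_def)
  obtain x \<alpha> where x: "x \<in> Y" and \<alpha>: "\<And>n. \<alpha> n \<noteq> []" "\<And>n. sorted_wrt (<) (\<alpha> n)"
    "\<And>n m. m \<in> set (\<alpha> n) \<Longrightarrow> N < m"
    "\<And>n m m'. m \<in> set (\<alpha> n) \<Longrightarrow> m' \<in> set (\<alpha> (Suc n)) \<Longrightarrow> m < m'"
    and lim: "\<And>j. j \<in> J \<Longrightarrow> (\<lambda>n. comp_list (w j) (\<alpha> n) x) \<longlonglongrightarrow> x"
    using M.jointly_recurrent_point[where N = N, OF J w] by blast
  have xX: "x \<in> X" using x Y by blast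
  define A where "A n = set (\<alpha> n)" for n
  define \<beta> where "\<beta> n = frac_block (A n)" for n
  define \<gamma> where "\<gamma> n = int_block (A n)" for n
  have A: "finite (A n)" "A n \<noteq> {}" for n using \<alpha>(1)[of n] by (simp_all add: A_def)
  have AN: "N < m" if "m \<in> A n" for m n using that \<alpha>(3) by (simp add: A_def)
  have kN: "k \<le> N" by (simp add: N_def)
  have le: "1 \<le> m \<and> p \<le> m \<and> q \<le> m" if "m \<in> A n" "p \<le> k" "q \<le> k" for m n p q
    using AN[OF that(1)] kN that(2,3) by linarith
  have neg: "rdom_neg (of_nat p * \<beta> n + of_nat q * of_int (\<gamma> n)) = (if p = 0 then {} else (\<lambda>m. - int m) ` A n)"
    and pos: "rdom_pos (of_nat p * \<beta> n + of_nat q * of_int (\<gamma> n)) = (if q = 0 then {} else int ` A n)"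
    if "p \<le> k" "q \<le> k" for p q n
    unfolding \<beta>_def \<gamma>_def using A le that by (intro rdom_block; blast)+
  \<comment> \<open>The pairs (1,0), (0,1) and (1,1) for \<open>(p, q)\<close> give \<beta>,
    \<gamma> and their sum; they are allowed because \<open>k \<ge> 1\<close>.\<close>
  have neg\<beta>: "rdom_neg (\<beta> n) = (\<lambda>m. - int m) ` A n" and pos\<beta>: "rdom_pos (\<beta> n) = {}"
    and neg\<gamma>: "rdom_neg (of_int (\<gamma> n)) = {}" and pos\<gamma>: "rdom_pos (of_int (\<gamma> n)) = int ` A n"
    and neg\<beta>\<gamma>: "rdom_neg (\<beta> n + of_int (\<gamma> n)) = (\<lambda>m. - int m) ` A n"
    and pos\<beta>\<gamma>: "rdom_pos (\<beta> n + of_int (\<gamma> n)) = int ` A n" for n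
    using neg[of 1 0 n] neg[of 0 1 n] neg[of 1 1 n] pos[of 1 0 n] pos[of 0 1 n] pos[of 1 1 n] assms(3)
    by simp_all
  have "\<beta> n \<notin> \<int>" for n
    unfolding \<beta>_def using A le[of _ n 0 0] by (intro frac_block_not_Ints) auto
  moreover have "\<gamma> n \<noteq> 0" for n
  proof
    assume "\<gamma> n = 0"
    then have "rdom_pos 0 = int ` A n" using pos\<gamma>[of n] by simp
    then show False using A by (simp add: rdom_pos_def rdom_zero)
  qed
  moreover have "\<beta> n + of_int (\<gamma> n) \<prec> \<beta> (n + 1) + of_int (\<gamma> (n + 1))" for n
  proof -
    have "m < m'" if "m \<in> A n" "m' \<in> A (n + 1)" for m m'
      using \<alpha>(4) that by (simp add: A_def)
    moreover have "Min ((\<lambda>m. - int m) ` A n) < Max (int ` A n)"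
    proof -
      obtain m where m: "m \<in> A n" using A by blast
      have "Min ((\<lambda>m. - int m) ` A n) \<le> - int m" using A m by (intro Min_le) auto
      also have "\<dots> < int m" using AN[OF m] by simp
      also have "\<dots> \<le> Max (int ` A n)" using A m by (intro Max_ge) auto
      finally show ?thesis .
    qed
    ultimately show ?thesis unfolding rat_prec_def neg\<beta>\<gamma> pos\<beta>\<gamma>
      using A by auto
  qed
  moreover have bound: "- real m < k1 \<and> k2 < real m" if "m \<in> A 1" for m
  proof -
    have "\<bar>k1\<bar> + \<bar>k2\<bar> \<le> real N" by (simp add: N_def) linarith
    moreover have "real N < real m" using AN[OF that] by simp
    ultimately show ?thesis by linarith
  qed
  moreover have "real_of_int (Max (rdom_neg (\<beta> 1))) < k1"
  proof -
    have "Max (rdom_neg (\<beta> 1)) \<in> (\<lambda>m. - int m) ` A 1" unfolding neg\<beta> using A by (intro Max_in) auto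
    then show ?thesis using bound by auto
  qed
  moreover have "k2 < real_of_int (Min (rdom_pos (of_int (\<gamma> 1))))"
  proof -
    have "Min (rdom_pos (of_int (\<gamma> 1))) \<in> int ` A 1" unfolding pos\<gamma> using A by (intro Min_in) auto
    then show ?thesis using bound by auto
  qed
  moreover have "(\<lambda>n. \<T> i (of_int p * \<beta> n + of_int q * of_int (\<gamma> n)) x) \<longlonglongrightarrow> x"
    if i: "i \<in> {1..l}" and pq: "0 \<le> p" "p \<le> int k" "0 \<le> q" "q \<le> int k" for i and p q :: int
  proof -
    obtain p' q' where p': "p = int p'" "q = int q'" "p' \<le> k" "q' \<le> k"
      using pq by (metis nonneg_int_cases of_nat_le_iff)
    \<comment> \<open>For each \<open>n\<close> the action of this rational is exactly the product
      of \<open>w (i, p', q')\<close> along the block, so the limit is the recurrence already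
      obtained.\<close>
    have "\<T> i (of_int p * \<beta> n + of_int q * of_int (\<gamma> n)) x = comp_list (w (i, p', q')) (\<alpha> n) x" for n
    proof -
      have "distinct (\<alpha> n)" using \<alpha>(2)[of n] strict_sorted_iff by blast
      then have "rational_family (U i) (of_nat p' * \<beta> n + of_nat q' * of_int (\<gamma> n))
          = comp_list (w (i, p', q')) (\<alpha> n)"
        unfolding \<beta>_def \<gamma>_def A_def w_def split
        by (intro rational_family_block commute U[rule_format]) (use le[of _ n p' q'] p' in \<open>auto simp: A_def\<close>)
      then show ?thesis using fam i xX by (simp add: p'(1,2))
    qed
    moreover have "(i, p', q') \<in> J" using i p' by (simp add: J_def)
    ultimately show ?thesis using lim by simp
  qed
  ultimately show ?thesis using xX pos\<beta> neg\<gamma>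
    by (intro bexI[of _ x] exI[of _ \<beta>] exI[of _ \<gamma>]) auto
qed

end
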